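(* Let $K_1$ and $K_2$ be two scalar valued sharp positive definite kernels on $\mathbb D\times\mathbb D$, and let $n\geq 0$ be an integer. If the multiplication operators $M_z$ on $(\mathcal H,K_1)$ and on $(\mathcal H,K_2)$ are weakly homogeneous, then $M_z$ on $\big(\mathcal H,J_n(K_1,K_2)_{|\mathrm{res}\,\Delta}\big)$ is also weakly homogeneous.
   Context: $\mathbb D$ is the open unit disc; Möb is the group of all biholomorphic automorphisms of $\mathbb D$. A bounded operator $T$ is weakly homogeneous if $\sigma(T)\subseteq\overline{\mathbb D}$ and $\varphi(T)$ (holomorphic functional calculus) is similar to $T$, i.e. $\varphi(T)=LTL^{-1}$ for some bounded invertible $L$, for all $\varphi\in$ Möb. Kernels are holomorphic in the first variable and anti-holomorphic in the second. An $\mathcal M_k(\mathbb C)$-valued kernel $K$ on $\mathbb D\times \mathbb D$ is non-negative (resp. positive) definite if for all finite sets of distinct points $w_1,\dots,w_l$ the block matrix $(K(w_i,w_j))_{i,j}$ is non-negative definite (resp. non-negative definite and invertible). $(\mathcal H,K)$ is the associated reproducing kernel Hilbert space of $\mathbb C^k$-valued holomorphic functions; $M_z$ is multiplication by the coordinate function. A scalar positive definite kernel $K$ is sharp if $M_z$ is bounded on $(\mathcal H,K)$ and $\ker(M_z^*-\bar w)$ is spanned by $K(\cdot,w)$ for all $w\in\mathbb D$. $J_n(K_1,K_2)_{|\mathrm{res}\,\Delta}$ is the non-negative definite $\mathcal M_{n+1}(\mathbb C)$-valued kernel $$J_n(K_1,K_2)_{|\mathrm{res}\,\Delta}(z,w)=\Big(K_1(z,w)\big(\tfrac{\partial}{\partial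 z}\big)^i\big(\tfrac{\partial}{\partial\bar w}\big)^jK_2(z,w)\Big)_{i,j=0}^n .$$ *)

theory Defs
  imports "HOL-Complex_Analysis.Complex_Analysis" "HOL-Library.Function_Algebras"
begin

section \<open>Hilbert spaces of vector-valued functions\<close>

text \<open>
  A \<open>\<complex>\<^sup>k\<close>-valued function on a set of complex numbers is represented by its components
  \<open>f z i\<close>, \<open>i < k\<close>. Addition, subtraction and zero are the pointwise ones of
  \<^theory>\<open>HOL-Library.Function_Algebras\<close>.
\<close>

type_synonym vfun = "complex \<Rightarrow> nat \<Rightarrow> complex"

definition cscale :: "complex \<Rightarrow> vfun \<Rightarrow> vfun" where
  "cscale c f = (\<lambda>z i. c * f z i)"

global_interpretation vfun: vector_space cscale
  by unfold_locales (auto simp: cscale_def fun_eq_iff algebra_simps)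

record hspace =
  carr :: "vfun set"
  ip :: "vfun \<Rightarrow> vfun \<Rightarrow> complex"

definition hnorm :: "hspace \<Rightarrow> vfun \<Rightarrow> real" where
  "hnorm H f = sqrt (Re (ip H f f))"

locale hilbert_space =
  fixes H :: hspace
  assumes subspace: "vfun.subspace (carr H)"
    and ip_add: "\<lbrakk>f \<in> carr H; g \<in> carr H; h \<in> carr H\<rbrakk> \<Longrightarrow> ip H (f + g) h = ip H f h + ip H g h"
    and ip_scale: "\<lbrakk>f \<in> carr H; h \<in> carr H\<rbrakk> \<Longrightarrow> ip H (cscale c f) h = c * ip H f h"
    and ip_commute: "\<lbrakk>f \<in> carr H; g \<in> carr H\<rbrakk> \<Longrightarrow> ip H f g = cnj (ip H g f)"
    and ip_nonneg: "f \<in> carr H \<Longrightarrow> 0 \<le> Re (ip H f f)"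
    and ip_definite: "\<lbrakk>f \<in> carr H; ip H f f = 0\<rbrakk> \<Longrightarrow> f = 0"
    and complete:
      "\<lbrakk>\<And>n. X n \<in> carr H;
        \<And>e. 0 < e \<Longrightarrow> \<exists>N. \<forall>m\<ge>N. \<forall>n\<ge>N. hnorm H (X m - X n) < e\<rbrakk>
       \<Longrightarrow> \<exists>l\<in>carr H. (\<lambda>n. hnorm H (X n - l)) \<longlonglongrightarrow> 0"

section \<open>Operators\<close>

text \<open>Operators on \<open>H\<close> are HOL functions of which only the restriction to \<^term>\<open>carr H\<close> matters.\<close>

definition bounded_op :: "hspace \<Rightarrow> (vfun \<Rightarrow> vfun) \<Rightarrow> bool" where
  "bounded_op H T \<longleftrightarrow>
     (\<forall>f\<in>carr H. T f \<in> carr H) \<and>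
     (\<forall>f\<in>carr H. \<forall>g\<in>carr H. T (f + g) = T f + T g) \<and>
     (\<forall>c. \<forall>f\<in>carr H. T (cscale c f) = cscale c (T f)) \<and>
     (\<exists>C. \<forall>f\<in>carr H. hnorm H (T f) \<le> C * hnorm H f)"

definition invertible_op :: "hspace \<Rightarrow> (vfun \<Rightarrow> vfun) \<Rightarrow> bool" where
  "invertible_op H T \<longleftrightarrow>
     bounded_op H T \<and> bij_betw T (carr H) (carr H) \<and> bounded_op H (inv_into (carr H) T)"

definition adj :: "hspace \<Rightarrow> (vfun \<Rightarrow> vfun) \<Rightarrow> vfun \<Rightarrow> vfun" where
  "adj H T f = (THE g. g \<in> carr H \<and> (\<forall>h\<in>carr H. ip H (T h) f = ip H h g))"

definition op_spectrum :: "hspace \<Rightarrow> (vfun \<Rightarrow> vfun) \<Rightarrow> complex set" where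
  "op_spectrum H T = {\<zeta>. \<not> invertible_op H (\<lambda>f. cscale \<zeta> f - T f)}"

definition resolvent :: "hspace \<Rightarrow> (vfun \<Rightarrow> vfun) \<Rightarrow> complex \<Rightarrow> vfun \<Rightarrow> vfun" where
  "resolvent H T \<zeta> = inv_into (carr H) (\<lambda>f. cscale \<zeta> f - T f)"

definition similar_op :: "hspace \<Rightarrow> (vfun \<Rightarrow> vfun) \<Rightarrow> (vfun \<Rightarrow> vfun) \<Rightarrow> bool" where
  "similar_op H A T \<longleftrightarrow>
     (\<exists>L. invertible_op H L \<and> (\<forall>f\<in>carr H. A f = L (T (inv_into (carr H) L f))))"

text \<open>
  \<open>A = \<phi>(T)\<close> in the holomorphic functional calculus, for \<open>T\<close> with spectrum in the closed unit disc:
  \[ \phi(T) = \frac{1}{2\pi i}\oint_{|\zeta| = r} \phi(\zeta)\,(\zeta - T)^{-1}\,d\zeta, \]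
  the integral being taken weakly. Here \<open>\<phi>\<close> is only given on the open disc; \<open>F\<close> is its holomorphic
  extension to a neighbourhood of \<open>|\<zeta>| \<le> r\<close>, for some \<open>r > 1\<close>. The operator \<open>A\<close> does not depend on
  the choice of \<open>r\<close>.
\<close>

definition disc_calculus ::
  "hspace \<Rightarrow> (vfun \<Rightarrow> vfun) \<Rightarrow> (complex \<Rightarrow> complex) \<Rightarrow> (vfun \<Rightarrow> vfun) \<Rightarrow> bool" where
  "disc_calculus H T \<phi> A \<longleftrightarrow>
     bounded_op H A \<and>
     (\<exists>r F. 1 < r \<and> F analytic_on cball 0 r \<and> (\<forall>z\<in>ball 0 1. F z = \<phi> z) \<and>
        (\<forall>f\<in>carr H. \<forall>g\<in>carr H.
           ip H (A f) g =
             contour_integral (circlepath 0 r) (\<lambda>\<zeta>. F \<zeta> * ip H (resolvent H T \<zeta> f) g)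
               / (2 * of_real pi * \<i>)))"

definition moeb :: "(complex \<Rightarrow> complex) set" where
  "moeb = {\<phi>. bij_betw \<phi> (ball 0 1) (ball 0 1) \<and> \<phi> holomorphic_on ball 0 1 \<and>
              inv_into (ball 0 1) \<phi> holomorphic_on ball 0 1}"

definition weakly_homogeneous :: "hspace \<Rightarrow> (vfun \<Rightarrow> vfun) \<Rightarrow> bool" where
  "weakly_homogeneous H T \<longleftrightarrow>
     bounded_op H T \<and> op_spectrum H T \<subseteq> cball 0 1 \<and>
     (\<forall>\<phi>\<in>moeb. \<exists>A. disc_calculus H T \<phi> A \<and> similar_op H A T)"

section \<open>Kernels on the unit disc\<close>

text \<open>The entry \<open>(i, j)\<close> of \<open>K(z, w)\<close>, for an \<open>\<M>\<^sub>k(\<complex>)\<close>-valued \<open>K\<close>, is \<open>K z w i j\<close> with \<open>i, j < k\<close>.\<close>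

type_synonym mkernel = "complex \<Rightarrow> complex \<Rightarrow> nat \<Rightarrow> nat \<Rightarrow> complex"

definition scalar_kernel :: "(complex \<Rightarrow> complex \<Rightarrow> complex) \<Rightarrow> mkernel" where
  "scalar_kernel K = (\<lambda>z w i j. K z w)"

definition sesqui_holomorphic :: "nat \<Rightarrow> mkernel \<Rightarrow> bool" where
  "sesqui_holomorphic k K \<longleftrightarrow>
     (\<forall>i<k. \<forall>j<k.
        (\<forall>w\<in>ball 0 1. (\<lambda>z. K z w i j) holomorphic_on ball 0 1) \<and>
        (\<forall>z\<in>ball 0 1. (\<lambda>w. cnj (K z w i j)) holomorphic_on ball 0 1))"

text \<open>A real non-negative quadratic form over \<open>\<complex>\<close> makes the block matrix Hermitian.\<close>

definition nonneg_definite :: "nat \<Rightarrow> mkernel \<Rightarrow> bool" where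
  "nonneg_definite k K \<longleftrightarrow>
     (\<forall>W c. finite W \<and> W \<subseteq> ball 0 1 \<longrightarrow>
        (let q = (\<Sum>u\<in>W. \<Sum>v\<in>W. \<Sum>i<k. \<Sum>j<k. cnj (c u i) * K u v i j * c v j)
         in q \<in> \<real> \<and> 0 \<le> Re q))"

text \<open>\<open>B\<close> below is the inverse of the block matrix \<open>(K(u, v))\<close>, \<open>u, v \<in> W\<close>.\<close>

definition positive_definite :: "nat \<Rightarrow> mkernel \<Rightarrow> bool" where
  "positive_definite k K \<longleftrightarrow>
     nonneg_definite k K \<and>
     (\<forall>W. finite W \<and> W \<subseteq> ball 0 1 \<longrightarrow>
        (\<exists>B :: mkernel. \<forall>u\<in>W. \<forall>w\<in>W. \<forall>i<k. \<forall>j<k.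
           (\<Sum>v\<in>W. \<Sum>l<k. K u v i l * B v w l j) = (if u = w \<and> i = j then 1 else 0) \<and>
           (\<Sum>v\<in>W. \<Sum>l<k. B u v i l * K v w l j) = (if u = w \<and> i = j then 1 else 0)))"

text \<open>The function \<open>K(\<cdot>, w) \<eta>\<close>, for \<open>\<eta> \<in> \<complex>\<^sup>k\<close>, set to \<open>0\<close> outside its domain.\<close>

definition kernel_section :: "nat \<Rightarrow> mkernel \<Rightarrow> complex \<Rightarrow> (nat \<Rightarrow> complex) \<Rightarrow> vfun" where
  "kernel_section k K w \<eta> =
     (\<lambda>z i. if z \<in> ball 0 1 \<and> i < k then \<Sum>j<k. K z w i j * \<eta> j else 0)"

text \<open>
  \<open>H\<close> is the reproducing kernel Hilbert space \<open>(\<H>, K)\<close>. Setting functions to \<open>0\<close> outside the disc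
  and at indices \<open>\<ge> k\<close> makes equality in HOL the equality of \<open>\<complex>\<^sup>k\<close>-valued functions on the disc.
\<close>

locale rkhs = hilbert_space H for k :: nat and K :: mkernel and H :: hspace +
  assumes extensional: "\<lbrakk>f \<in> carr H; z \<notin> ball 0 1 \<or> k \<le> i\<rbrakk> \<Longrightarrow> f z i = 0"
    and holomorphic: "\<lbrakk>f \<in> carr H; i < k\<rbrakk> \<Longrightarrow> (\<lambda>z. f z i) holomorphic_on ball 0 1"
    and section_mem: "w \<in> ball 0 1 \<Longrightarrow> kernel_section k K w \<eta> \<in> carr H"
    and reproducing: "\<lbrakk>f \<in> carr H; w \<in> ball 0 1\<rbrakk> \<Longrightarrow>
      ip H f (kernel_section k K w \<eta>) = (\<Sum>j<k. f w j * cnj (\<eta> j))"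

definition mult_z :: "vfun \<Rightarrow> vfun" where
  "mult_z f = (\<lambda>z i. z * f z i)"

text \<open>
  Sharpness of a scalar kernel \<open>K\<close> whose reproducing kernel Hilbert space is \<open>H\<close>.
\<close>

definition sharp :: "(complex \<Rightarrow> complex \<Rightarrow> complex) \<Rightarrow> hspace \<Rightarrow> bool" where
  "sharp K H \<longleftrightarrow>
     bounded_op H mult_z \<and>
     (\<forall>w\<in>ball 0 1. {f \<in> carr H. adj H mult_z f = cscale (cnj w) f}
        = vfun.span {kernel_section 1 (scalar_kernel K) w (\<lambda>_. 1)})"

text \<open>
  On functions that are anti-holomorphic near \<open>w\<close> this is the Wirtinger derivative
  \<open>\<partial>/\<partial>w\<close>-bar.
\<close>

definition dbar :: "(complex \<Rightarrow> complex) \<Rightarrow> complex \<Rightarrow> complex" where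
  "dbar g w = cnj (deriv (\<lambda>v. cnj (g v)) w)"

text \<open>The entries of the \<open>\<M>\<^sub>n\<^sub>+\<^sub>1(\<complex>)\<close>-valued kernel \<open>J\<^sub>n(K\<^sub>1, K\<^sub>2)\<close> restricted to the diagonal.\<close>

definition jet_kernel ::
  "(complex \<Rightarrow> complex \<Rightarrow> complex) \<Rightarrow> (complex \<Rightarrow> complex \<Rightarrow> complex) \<Rightarrow> mkernel" where
  "jet_kernel K1 K2 =
     (\<lambda>z w i j. K1 z w * (deriv ^^ i) (\<lambda>x. (dbar ^^ j) (K2 x) w) z)"

end

theory Submission
  imports Defs
begin

text \<open>
  For \<open>\<phi> \<in> moeb\<close> the operator \<open>\<phi>(M\<^sub>z)\<close> is multiplication by \<open>\<phi>\<close>. If \<open>L\<close> realises its similarity to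
  \<open>M\<^sub>z\<close> on \<open>(\<H>, K\<^sub>i)\<close>, so that \<open>L M\<^sub>z = \<phi> L\<close>, then the adjoint of \<open>L\<close> sends the kernel function at \<open>w\<close>
  to an eigenvector of the adjoint of \<open>M\<^sub>z\<close> for the conjugate of \<open>\<phi>(w)\<close>. Sharpness says that this
  vector is a multiple of the kernel function at \<open>\<phi>(w)\<close>, which means that \<open>L\<close> is a weighted
  composition \<open>h \<mapsto> g\<^sub>i \<cdot> (h \<circ> \<phi>)\<close> with a nowhere vanishing holomorphic weight \<open>g\<^sub>i\<close>
  (\<open>intertwiner_is_weighted_composition\<close>).

  The tensor product of two such operators acts on functions of two variables by
  \<open>F(z, w) \<mapsto> g\<^sub>1(z) g\<^sub>2(w) F(\<phi>(z), \<phi>(w))\<close>, and it preserves the functions whose derivatives of order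
  at most \<open>n\<close> in the second variable vanish on the diagonal. It therefore induces an operator on the space of
  the jets \<open>(\<partial>\<^sub>2\<^sup>i F(z, z))\<close>, \<open>i \<le> n\<close>, and this space is the one with kernel \<open>J\<^sub>n(K\<^sub>1, K\<^sub>2)\<close>. On jets the induced
  operator is again a weighted composition, whose matrix weight is \<open>g\<^sub>1\<close> times the triangular matrix
  that expresses the derivatives of \<open>g\<^sub>2 \<cdot> (f \<circ> \<phi>)\<close> through those of \<open>f\<close>. It is invertible, because the
  same construction applies to the inverse operators, and it intertwines \<open>M\<^sub>z\<close> with multiplication
  by \<open>\<phi>\<close>.

  The tensor product itself is never formed. The kernel \<open>J\<^sub>n(K\<^sub>1, K\<^sub>2)\<close> is the product of the Gram
  matrix of kernel functions of \<open>K\<^sub>1\<close> and the Gram matrix of the vectors of \<open>(\<H>, K\<^sub>2)\<close> that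
  represent the derivative functionals. So boundedness of the induced operator becomes a statement
  about entrywise products of Gram matrices (\<open>tensor_contraction\<close>), which is where the Schur product
  theorem enters. Lemma \<open>jet_op_bounded\<close> turns this into the bound on the space of jets. The
  derivative functionals are bounded by the uniform boundedness principle and the Cauchy estimates.

  Lemma \<open>jet_op_bounded\<close>, with the identity on the second factor, shows that multiplication by \<open>z\<close>, by
  \<open>1 / (\<zeta> - z)\<close> for \<open>\<bar>\<zeta>\<bar> > 1\<close> and by \<open>\<phi>\<close> is bounded on the space of jets. This gives the spectral
  condition, and the Cauchy formula then identifies \<open>\<phi>(M\<^sub>z)\<close> with multiplication by \<open>\<phi>\<close>
  (\<open>disc_calculus_mult_fun\<close>).
\<close>

section \<open>Elementary geometry of the function spaces\<close>

lemma vminus_apply: "(f - g) z i = f z i - g z i" for f g :: vfun by (simp add: fun_diff_def)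
lemma cscale_apply: "cscale c f z i = c * f z i" by (simp add: cscale_def)

lemma vminus_eq_cscale: "f - g = f + cscale (-1) g" for f g :: vfun
  by (auto simp: fun_eq_iff vminus_apply cscale_apply)

context hilbert_space
begin

lemma mem_0: "0 \<in> carr H" and mem_add: "\<lbrakk>f \<in> carr H; g \<in> carr H\<rbrakk> \<Longrightarrow> f + g \<in> carr H"
  and mem_scale: "f \<in> carr H \<Longrightarrow> cscale c f \<in> carr H"
  and mem_diff: "\<lbrakk>f \<in> carr H; g \<in> carr H\<rbrakk> \<Longrightarrow> f - g \<in> carr H"
  and mem_sum: "(\<And>a. a \<in> A \<Longrightarrow> F a \<in> carr H) \<Longrightarrow> (\<Sum>a\<in>A. F a) \<in> carr H"
  using subspace vfun.subspace_0 vfun.subspace_add vfun.subspace_scale vfun.subspace_diff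
    vfun.subspace_sum by blast+

lemma ip_add_right: "\<lbrakk>f \<in> carr H; g \<in> carr H; h \<in> carr H\<rbrakk> \<Longrightarrow> ip H f (g + h) = ip H f g + ip H f h"
  by (metis ip_add ip_commute complex_cnj_add mem_add)

lemma ip_scale_right: "\<lbrakk>f \<in> carr H; h \<in> carr H\<rbrakk> \<Longrightarrow> ip H f (cscale c h) = cnj c * ip H f h"
  by (metis ip_scale ip_commute complex_cnj_mult complex_cnj_cnj mem_scale)

lemma ip_diff: "\<lbrakk>f \<in> carr H; g \<in> carr H; h \<in> carr H\<rbrakk> \<Longrightarrow> ip H (f - g) h = ip H f h - ip H g h"
  unfolding vminus_eq_cscale by (subst ip_add) (simp_all add: ip_scale mem_scale del: vfun.scale_minus_left)

lemma ip_diff_right: "\<lbrakk>f \<in> carr H; g \<in> carr H; h \<in> carr H\<rbrakk> \<Longrightarrow> ip H f (g - h) = ip H f g - ip H f h"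
  unfolding vminus_eq_cscale
  by (subst ip_add_right) (simp_all add: ip_scale_right mem_scale del: vfun.scale_minus_left)

lemma ip_zero: "f \<in> carr H \<Longrightarrow> ip H 0 f = 0" and ip_zero_right: "f \<in> carr H \<Longrightarrow> ip H f 0 = 0"
  using ip_scale[of f f 0] ip_scale_right[of f f 0] by simp_all

lemma ip_sum: "\<lbrakk>\<And>a. a \<in> A \<Longrightarrow> F a \<in> carr H; h \<in> carr H\<rbrakk> \<Longrightarrow>
    ip H (\<Sum>a\<in>A. F a) h = (\<Sum>a\<in>A. ip H (F a) h)"
proof (induction A rule: infinite_finite_induct)
  case (insert x A)
  then show ?case using ip_add[of "F x" "sum F A" h] mem_sum[of A F]
    by (simp only: sum.insert insert_iff simp_thms)
qed (simp_all add: ip_zero)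

lemma ip_sum_right: "\<lbrakk>\<And>a. a \<in> A \<Longrightarrow> F a \<in> carr H; h \<in> carr H\<rbrakk> \<Longrightarrow>
    ip H h (\<Sum>a\<in>A. F a) = (\<Sum>a\<in>A. ip H h (F a))"
proof (induction A rule: infinite_finite_induct)
  case (insert x A)
  then show ?case using ip_add_right[of h "F x" "sum F A"] mem_sum[of A F]
    by (simp only: sum.insert insert_iff simp_thms)
qed (simp_all add: ip_zero_right)

lemma ip_sum_sum: "\<lbrakk>\<And>a. a \<in> A \<Longrightarrow> F a \<in> carr H; \<And>b. b \<in> B \<Longrightarrow> G b \<in> carr H\<rbrakk> \<Longrightarrow>
    ip H (\<Sum>a\<in>A. F a) (\<Sum>b\<in>B. G b) = (\<Sum>a\<in>A. \<Sum>b\<in>B. ip H (F a) (G b))"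
  by (subst ip_sum) (auto simp: mem_sum ip_sum_right)

lemma hnorm_nonneg: "f \<in> carr H \<Longrightarrow> 0 \<le> hnorm H f"
  by (simp add: hnorm_def ip_nonneg)

lemma hnorm_sq: "f \<in> carr H \<Longrightarrow> (hnorm H f)\<^sup>2 = Re (ip H f f)"
  by (simp add: hnorm_def ip_nonneg)

lemma ip_self: "f \<in> carr H \<Longrightarrow> ip H f f = of_real ((hnorm H f)\<^sup>2)"
  by (metis Reals_cnj_iff complex_is_Real_iff hnorm_sq ip_commute of_real_Re)

lemma hnorm_eq_0: "f \<in> carr H \<Longrightarrow> hnorm H f = 0 \<longleftrightarrow> f = 0"
  using ip_self[of f] ip_definite ip_zero[OF mem_0] by auto

lemma hnorm_zero: "hnorm H 0 = 0"
  using hnorm_eq_0 mem_0 by blast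

lemma hnorm_scale: "f \<in> carr H \<Longrightarrow> hnorm H (cscale c f) = cmod c * hnorm H f"
proof -
  assume f: "f \<in> carr H"
  have "ip H (cscale c f) (cscale c f) = of_real ((cmod c)\<^sup>2) * ip H f f"
    using f unfolding complex_norm_square
    by (simp only: ip_scale ip_scale_right mem_scale mult_ac)
  then have "Re (ip H (cscale c f) (cscale c f)) = (cmod c)\<^sup>2 * Re (ip H f f)"
    by (simp del: of_real_power)
  then show ?thesis by (simp add: hnorm_def real_sqrt_mult)
qed

lemma hnorm_add_sq:
  assumes "f \<in> carr H" "g \<in> carr H"
  shows "(hnorm H (f + g))\<^sup>2 = (hnorm H f)\<^sup>2 + 2 * Re (ip H f g) + (hnorm H g)\<^sup>2"
  using assms ip_commute[of g f]
  by (simp add: hnorm_sq mem_add ip_add ip_add_right)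

lemma hnorm_minus_commute: "\<lbrakk>f \<in> carr H; g \<in> carr H\<rbrakk> \<Longrightarrow> hnorm H (f - g) = hnorm H (g - f)"
  using hnorm_scale[of "g - f" "-1"] mem_diff[of g f]
  by (simp add: cscale_def fun_diff_def)

lemma cauchy_schwarz:
  assumes f: "f \<in> carr H" and g: "g \<in> carr H"
  shows "cmod (ip H f g) \<le> hnorm H f * hnorm H g"
proof (cases "hnorm H g = 0")
  case True
  then have "g = 0" using hnorm_eq_0 g by simp
  then show ?thesis using f by (simp add: ip_zero_right hnorm_zero)
next
  case False
  then have pos: "0 < hnorm H g" using hnorm_nonneg[OF g] by simp
  define N where "N = (hnorm H g)\<^sup>2"
  define c where "c = - (ip H f g / of_real N)"
  have N: "0 < N" using pos by (simp add: N_def)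
  have cm: "(cmod c)\<^sup>2 = (cmod (ip H f g))\<^sup>2 / N\<^sup>2"
    using N by (simp add: c_def norm_divide power_divide)
  have "Re (cnj c * ip H f g) = - ((cmod (ip H f g))\<^sup>2 / N)"
  proof -
    have "cnj c * ip H f g = of_real (- ((cmod (ip H f g))\<^sup>2 / N))"
      unfolding of_real_minus of_real_divide complex_norm_square c_def by simp
    then show ?thesis by (simp only: Re_complex_of_real)
  qed
  then have "(hnorm H (f + cscale c g))\<^sup>2 = (hnorm H f)\<^sup>2 - 2 * ((cmod (ip H f g))\<^sup>2 / N) + (cmod c)\<^sup>2 * N"
    using hnorm_add_sq[OF f mem_scale[OF g, of c]] f g
    by (simp add: ip_scale_right hnorm_scale N_def power_mult_distrib)
  also have "(cmod c)\<^sup>2 * N = (cmod (ip H f g))\<^sup>2 / N"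
    unfolding cm using N by (simp add: power2_eq_square)
  finally have "0 \<le> (hnorm H f)\<^sup>2 - (cmod (ip H f g))\<^sup>2 / N"
    using zero_le_power2[of "hnorm H (f + cscale c g)"] by linarith
  then have "(cmod (ip H f g))\<^sup>2 \<le> (hnorm H f * hnorm H g)\<^sup>2"
    using N by (simp add: field_simps N_def)
  then show ?thesis
    by (rule power2_le_imp_le) (simp add: hnorm_nonneg f g)
qed

lemma hnorm_triangle:
  assumes "f \<in> carr H" "g \<in> carr H"
  shows "hnorm H (f + g) \<le> hnorm H f + hnorm H g"
proof -
  have "Re (ip H f g) \<le> hnorm H f * hnorm H g"
    using cauchy_schwarz[OF assms] complex_Re_le_cmod order_trans by blast
  then have "(hnorm H (f + g))\<^sup>2 \<le> (hnorm H f + hnorm H g)\<^sup>2"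
    using hnorm_add_sq[OF assms] by (simp add: power2_sum)
  then show ?thesis
    by (rule power2_le_imp_le) (simp add: hnorm_nonneg assms)
qed

lemma hnorm_triangle_diff:
  assumes "f \<in> carr H" "g \<in> carr H" "h \<in> carr H"
  shows "hnorm H (f - h) \<le> hnorm H (f - g) + hnorm H (g - h)"
  using hnorm_triangle[of "f - g" "g - h"] assms by (simp add: mem_diff)

lemma hnorm_diff_le:
  assumes "f \<in> carr H" "g \<in> carr H"
  shows "hnorm H (f - g) \<le> hnorm H f + hnorm H g"
  using hnorm_triangle_diff[OF assms(1) mem_0 assms(2)] hnorm_minus_commute[OF mem_0 assms(2)] by simp

lemma hnorm_le_add_diff:
  assumes "f \<in> carr H" "g \<in> carr H"
  shows "hnorm H f \<le> hnorm H g + hnorm H (f - g)"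
  using hnorm_triangle[of g "f - g"] assms by (simp add: mem_diff)

lemma eq_of_ip_eq:
  assumes "f \<in> carr H" "g \<in> carr H" "\<And>h. h \<in> carr H \<Longrightarrow> ip H h f = ip H h g"
  shows "f = g"
proof -
  have "ip H (f - g) (f - g) = 0"
    using assms by (simp add: ip_diff_right mem_diff)
  then show ?thesis using ip_definite[OF mem_diff] assms(1,2) by fastforce
qed

lemma parallelogram:
  assumes "f \<in> carr H" "g \<in> carr H"
  shows "(hnorm H (f - g))\<^sup>2 = 2 * (hnorm H f)\<^sup>2 + 2 * (hnorm H g)\<^sup>2 - (hnorm H (f + g))\<^sup>2"
  using hnorm_add_sq[OF assms] hnorm_add_sq[OF assms(1) mem_scale[OF assms(2), of "-1"]] assms
  unfolding vminus_eq_cscale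
  by (simp add: ip_scale_right hnorm_scale del: vfun.scale_minus_left)


end

section \<open>Representation of bounded linear relations\<close>

context hilbert_space
begin

lemma ip_tendsto:
  assumes X: "\<And>n. X n \<in> carr H" and l: "l \<in> carr H" and h: "h \<in> carr H"
    and lim: "(\<lambda>n. hnorm H (X n - l)) \<longlonglongrightarrow> 0"
  shows "(\<lambda>n. ip H (X n) h) \<longlonglongrightarrow> ip H l h"
proof -
  have "(\<lambda>n. ip H (X n) h - ip H l h) \<longlonglongrightarrow> 0"
  proof (rule Lim_null_comparison)
    show "\<forall>\<^sub>F n in sequentially. norm (ip H (X n) h - ip H l h) \<le> hnorm H (X n - l) * hnorm H h"
      using cauchy_schwarz[OF mem_diff[OF X l] h] X l h by (simp add: ip_diff)
    show "(\<lambda>n. hnorm H (X n - l) * hnorm H h) \<longlonglongrightarrow> 0"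
      using tendsto_mult_right[OF lim, of "hnorm H h"] by simp
  qed
  then show ?thesis by (simp add: LIM_zero_iff)
qed

text \<open>
  The Riesz representation theorem, for a functional that is given on a subspace through the
  pairs (argument, value). Stating it for a linear relation \<open>R\<close> allows the argument to be written
  as a linear combination in several ways: the bound on \<open>R\<close> already forces the values to agree.
  The representing vector is the limit of a minimising sequence of \<open>\<parallel>h\<parallel>\<^sup>2 - 2 Re s\<close> over \<open>R\<close>, which is
  a Cauchy sequence by the parallelogram law. Since the limit lies in the closure of the subspace,
  its norm is at most the norm of the functional.
\<close>
lemma riesz_relation:
  assumes R: "\<And>h s. (h, s) \<in> R \<Longrightarrow> h \<in> carr H"
    and bound: "\<And>h s. (h, s) \<in> R \<Longrightarrow> cmod s \<le> M * hnorm H h"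
    and ne: "R \<noteq> {}"
    and add: "\<And>h s h' s'. \<lbrakk>(h, s) \<in> R; (h', s') \<in> R\<rbrakk> \<Longrightarrow> (h + h', s + s') \<in> R"
    and scale: "\<And>h s c. (h, s) \<in> R \<Longrightarrow> (cscale c h, c * s) \<in> R"
    and M: "0 \<le> M"
  obtains l where "l \<in> carr H" "hnorm H l \<le> M" "\<And>h s. (h, s) \<in> R \<Longrightarrow> ip H h l = s"
proof -
  define J where "J p = (hnorm H (fst p))\<^sup>2 - 2 * Re (snd p)" for p
  define m where "m = Inf (J ` R)"
  have Jlow: "- M\<^sup>2 \<le> J p" if "p \<in> R" for p
  proof -
    have "Re (snd p) \<le> M * hnorm H (fst p)"
      using bound[of "fst p" "snd p"] that complex_Re_le_cmod[of "snd p"] by simp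
    moreover have "0 \<le> (hnorm H (fst p) - M)\<^sup>2" by simp
    ultimately show ?thesis by (simp add: J_def power2_diff mult.commute)
  qed
  have bdd: "bdd_below (J ` R)" using Jlow by (rule bdd_belowI2)
  have mle: "m \<le> J p" if "p \<in> R" for p
    unfolding m_def using that bdd by (simp add: cINF_lower)
  have "\<exists>p\<in>R. J p < m + inverse (real (Suc n))" for n
  proof -
    have "Inf (J ` R) < m + inverse (real (Suc n))" by (simp add: m_def)
    then show ?thesis using ne bdd by (subst (asm) cINF_less_iff) auto
  qed
  then obtain p where p: "\<And>n. p n \<in> R" and pm: "\<And>n. J (p n) < m + inverse (real (Suc n))"
    by metis
  define X where "X n = fst (p n)" for n
  define s where "s n = snd (p n)" for n
  have XR: "(X n, s n) \<in> R" for n using p by (simp add: X_def s_def)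
  have X: "X n \<in> carr H" for n using XR R by blast
  have Jadd: "(hnorm H (X n - X k))\<^sup>2 \<le> 2 * inverse (real (Suc n)) + 2 * inverse (real (Suc k))" for n k
  proof -
    have "m \<le> J (cscale (1/2) (X n + X k), (1/2) * (s n + s k))"
      using mle scale add XR by blast
    moreover have "hnorm H (cscale (1/2) (X n + X k)) = hnorm H (X n + X k) / 2"
      by (subst hnorm_scale) (auto simp: X mem_add)
    ultimately have "m \<le> (hnorm H (X n + X k))\<^sup>2 / 4 - Re (s n) - Re (s k)"
      unfolding J_def fst_conv snd_conv by (simp add: power_divide add_divide_distrib)
    moreover have "(hnorm H (X j))\<^sup>2 - 2 * Re (s j) < m + inverse (real (Suc j))" for j
      using pm[of j] unfolding J_def X_def s_def .
    from this[of n] this[of k] have "(hnorm H (X n))\<^sup>2 - 2 * Re (s n) + (hnorm H (X k))\<^sup>2 - 2 * Re (s k)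
        < 2 * m + inverse (real (Suc n)) + inverse (real (Suc k))" by linarith
    ultimately show ?thesis
      unfolding parallelogram[OF X[of n] X[of k]] by linarith
  qed
  have "\<exists>N. \<forall>n\<ge>N. \<forall>k\<ge>N. hnorm H (X n - X k) < e" if e: "0 < e" for e
  proof -
    obtain N where N: "inverse (real (Suc N)) < e\<^sup>2 / 4"
      using reals_Archimedean[of "e\<^sup>2 / 4"] e by auto
    have "hnorm H (X n - X k) < e" if "N \<le> n" "N \<le> k" for n k
    proof -
      have "inverse (real (Suc n)) \<le> inverse (real (Suc N))" "inverse (real (Suc k)) \<le> inverse (real (Suc N))"
        using that by (auto simp: field_simps)
      then have "(hnorm H (X n - X k))\<^sup>2 < e\<^sup>2"
        using Jadd[of n k] N by linarith
      then show ?thesis using e power_less_imp_less_base[of _ 2 e] by simp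
    qed
    then show ?thesis by blast
  qed
  then obtain l where l: "l \<in> carr H" and lim: "(\<lambda>n. hnorm H (X n - l)) \<longlonglongrightarrow> 0"
    using complete[of X] X by blast
  have rep: "ip H h l = t" if ht: "(h, t) \<in> R" for h t
  proof -
    have h: "h \<in> carr H" using R ht .
    define d where "d = ip H l h - cnj t"
    have key: "0 \<le> 2 * Re (cnj c * d) + (cmod c)\<^sup>2 * (hnorm H h)\<^sup>2" for c
    proof -
      have "m \<le> m + inverse (real (Suc n)) + 2 * Re (cnj c * (ip H (X n) h - cnj t)) + (cmod c)\<^sup>2 * (hnorm H h)\<^sup>2" for n
      proof -
        have "m \<le> J (X n + cscale c h, s n + c * t)"
          using mle add scale XR ht by blast
        also have "\<dots> = J (p n) + 2 * Re (cnj c * ip H (X n) h) - 2 * Re (c * t) + (cmod c)\<^sup>2 * (hnorm H h)\<^sup>2"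
          using X h by (simp add: J_def hnorm_add_sq mem_scale ip_scale_right hnorm_scale
            power_mult_distrib X_def s_def)
        also have "Re (c * t) = Re (cnj c * cnj t)" by simp
        finally show ?thesis using pm[of n] by (simp add: algebra_simps)
      qed
      then have "0 \<le> inverse (real (Suc n)) + 2 * Re (cnj c * (ip H (X n) h - cnj t)) + (cmod c)\<^sup>2 * (hnorm H h)\<^sup>2" for n
        using add_le_cancel_left[of m 0] by (simp add: add.assoc)
      moreover have "(\<lambda>n. inverse (real (Suc n)) + 2 * Re (cnj c * (ip H (X n) h - cnj t)) + (cmod c)\<^sup>2 * (hnorm H h)\<^sup>2)
          \<longlonglongrightarrow> 0 + 2 * Re (cnj c * (ip H l h - cnj t)) + (cmod c)\<^sup>2 * (hnorm H h)\<^sup>2"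
        by (intro tendsto_intros LIMSEQ_inverse_real_of_nat ip_tendsto X l h lim)
      ultimately show ?thesis
        unfolding d_def by (metis (no_types, lifting) LIMSEQ_le_const add_0)
    qed
    have "d = 0"
    proof (rule ccontr)
      assume d: "d \<noteq> 0"
      \<comment> \<open>Any step length smaller than \<open>2 / \<parallel>h\<parallel>\<^sup>2\<close> in the direction \<open>- d\<close> decreases the functional;
        the summand 1 covers \<open>h = 0\<close>.\<close>
      define e where "e = inverse ((hnorm H h)\<^sup>2 + 1)"
      have e: "0 < e" "e * (hnorm H h)\<^sup>2 < 1"
        by (auto simp: e_def field_simps add_pos_nonneg add_nonneg_pos)
      have "cnj (- of_real e * d) * d = of_real (- e * (cmod d)\<^sup>2)"
        unfolding of_real_mult complex_norm_square by simp
      then have "Re (cnj (- of_real e * d) * d) = - e * (cmod d)\<^sup>2"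
        by (simp only: Re_complex_of_real)
      moreover have "(cmod (- of_real e * d))\<^sup>2 = e * (e * (cmod d)\<^sup>2)"
        using e by (simp add: norm_mult power2_eq_square)
      ultimately have "0 \<le> e * (cmod d)\<^sup>2 * (e * (hnorm H h)\<^sup>2 - 2)"
        using key[of "- of_real e * d"] by (simp add: algebra_simps)
      moreover have "0 < e * (cmod d)\<^sup>2" using e d by simp
      ultimately show False using e by (simp add: zero_le_mult_iff)
    qed
    then show ?thesis using ip_commute[OF h l] by (simp add: d_def)
  qed
  have "hnorm H l \<le> M"
  proof (cases "hnorm H l = 0")
    case False
    then have pos: "0 < hnorm H l" using hnorm_nonneg[OF l] by simp
    have "cmod (ip H (X n) l) \<le> M * (hnorm H l + hnorm H (X n - l))" for n
      using rep[OF XR] bound[OF XR, of n] hnorm_le_add_diff[OF X l] M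
      by (smt (verit) mult_left_mono)
    moreover have "(\<lambda>n. M * (hnorm H l + hnorm H (X n - l))) \<longlonglongrightarrow> M * (hnorm H l + 0)"
      by (intro tendsto_intros lim)
    moreover have "(\<lambda>n. cmod (ip H (X n) l)) \<longlonglongrightarrow> cmod (ip H l l)"
      by (intro tendsto_intros ip_tendsto X l lim)
    ultimately have "cmod (ip H l l) \<le> M * (hnorm H l + 0)"
      by (meson LIMSEQ_le)
    moreover have "cmod (ip H l l) = hnorm H l * hnorm H l"
      unfolding ip_self[OF l] by (simp add: power2_eq_square norm_mult hnorm_nonneg[OF l])
    ultimately show ?thesis using pos by simp
  qed (use M in simp)
  then show ?thesis using that l rep by blast
qed

end

section \<open>The uniform boundedness principle\<close>

context hilbert_space
begin

text \<open>
  The Baire category theorem on \<^term>\<open>carr H\<close>: one of the closed sets on which all functionals are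
  bounded by \<open>n\<close> contains a ball, and linearity transports the bound from this ball to the origin.
\<close>
lemma uniform_boundedness:
  assumes g: "\<And>i. i \<in> I \<Longrightarrow> g i \<in> carr H"
    and pointwise: "\<And>f. f \<in> carr H \<Longrightarrow> \<exists>B. \<forall>i\<in>I. cmod (ip H f (g i)) \<le> B"
  obtains C where "0 \<le> C" "\<And>i f. i \<in> I \<Longrightarrow> f \<in> carr H \<Longrightarrow> cmod (ip H f (g i)) \<le> C * hnorm H f"
proof -
  \<comment> \<open>\<^locale>\<open>Metric_space\<close> asks for a symmetric non-negative function on the whole type.\<close>
  define d where "d f h = (if f \<in> carr H \<and> h \<in> carr H then hnorm H (f - h) else 0)" for f h
  interpret M: Metric_space "carr H" d
  proof
    show "0 \<le> d x y" for x y by (auto simp: d_def intro: hnorm_nonneg mem_diff)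
    show "d x y = d y x" for x y by (auto simp: d_def intro: hnorm_minus_commute)
    show "d x y = 0 \<longleftrightarrow> x = y" if "x \<in> carr H" "y \<in> carr H" for x y
      using that hnorm_eq_0[OF mem_diff[OF that]] by (simp add: d_def)
    show "d x z \<le> d x y + d y z" if "x \<in> carr H" "y \<in> carr H" "z \<in> carr H" for x y z
      using hnorm_triangle_diff that by (simp add: d_def)
  qed
  have mcomplete: "M.mcomplete"
    unfolding M.mcomplete_def
  proof (intro allI impI)
    fix X assume X: "M.MCauchy X"
    then have mem: "X n \<in> carr H" for n by (auto simp: M.MCauchy_def)
    have "\<exists>N. \<forall>m\<ge>N. \<forall>n\<ge>N. hnorm H (X m - X n) < e" if "0 < e" for e
      using X that mem by (fastforce simp: M.MCauchy_def d_def)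
    then obtain l where "l \<in> carr H" "(\<lambda>n. hnorm H (X n - l)) \<longlonglongrightarrow> 0"
      using complete[of X] mem by blast
    then show "\<exists>x. limitin M.mtopology X x sequentially"
      using mem by (auto simp: M.limitin_metric_dist_null d_def intro!: exI[of _ l])
  qed
  define E where "E n = {f \<in> carr H. \<forall>i\<in>I. cmod (ip H f (g i)) \<le> real n}" for n
  have closed: "closedin M.mtopology (E n)" for n
    unfolding M.metric_closedin_iff_sequentially_closed
  proof (intro conjI allI impI)
    show "E n \<subseteq> carr H" by (auto simp: E_def)
    fix X l assume *: "range X \<subseteq> E n \<and> limitin M.mtopology X l sequentially"
    then have X: "X k \<in> E n" for k by blast
    then have mem: "X k \<in> carr H" for k by (simp add: E_def)
    from * mem have l: "l \<in> carr H" and lim: "(\<lambda>k. hnorm H (X k - l)) \<longlonglongrightarrow> 0"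
      by (auto simp: M.limitin_metric_dist_null d_def)
    have "cmod (ip H l (g i)) \<le> real n" if i: "i \<in> I" for i
    proof (rule LIMSEQ_le_const2)
      show "(\<lambda>k. cmod (ip H (X k) (g i))) \<longlonglongrightarrow> cmod (ip H l (g i))"
        by (intro tendsto_norm ip_tendsto mem l g i lim)
      show "\<exists>N. \<forall>k\<ge>N. cmod (ip H (X k) (g i)) \<le> real n"
        using X i by (auto simp: E_def)
    qed
    then show "l \<in> E n" using l by (simp add: E_def)
  qed
  have "\<Union>(range E) = carr H"
  proof
    show "\<Union>(range E) \<subseteq> carr H" by (auto simp: E_def)
    show "carr H \<subseteq> \<Union>(range E)"
    proof
      fix f assume f: "f \<in> carr H"
      then obtain B where B: "\<forall>i\<in>I. cmod (ip H f (g i)) \<le> B" using pointwise by blast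
      obtain n :: nat where "B \<le> real n" using real_arch_simple by blast
      then have "f \<in> E n" using f B by (auto simp: E_def intro: order_trans)
      then show "f \<in> \<Union>(range E)" by blast
    qed
  qed
  moreover have "M.mtopology interior_of carr H = carr H"
    by (metis M.topspace_mtopology interior_of_topspace)
  ultimately have "M.mtopology interior_of \<Union>(range E) \<noteq> {}" using mem_0 by auto
  then obtain n where "M.mtopology interior_of E n \<noteq> {}"
    using M.metric_Baire_category_alt[OF mcomplete, of "range E"] closed by auto
  then obtain f0 where f0_int: "f0 \<in> M.mtopology interior_of E n" by blast
  then have f0: "f0 \<in> carr H"
    using interior_of_subset[of M.mtopology "E n"] by (auto simp: E_def)
  have "openin M.mtopology (M.mtopology interior_of E n)" by simp
  then obtain e where e: "0 < e" and sub: "M.mball f0 e \<subseteq> M.mtopology interior_of E n"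
    using f0_int unfolding M.openin_mtopology by blast
  then have sub: "M.mball f0 e \<subseteq> E n"
    using interior_of_subset[of M.mtopology "E n"] by blast
  show ?thesis
  proof
    show "0 \<le> 4 * real n / e" using e by simp
    fix i f assume i: "i \<in> I" and f: "f \<in> carr H"
    show "cmod (ip H f (g i)) \<le> 4 * real n / e * hnorm H f"
    proof (cases "hnorm H f = 0")
      case True
      then show ?thesis using hnorm_eq_0[OF f] g[OF i] by (simp add: ip_zero)
    next
      case False
      then have pos: "0 < hnorm H f" using hnorm_nonneg[OF f] by simp
      define t where "t = e / (2 * hnorm H f)"
      have t: "0 < t" using e pos by (simp add: t_def)
      define f1 where "f1 = f0 + cscale (of_real t) f"
      have f1: "f1 \<in> carr H" by (simp add: f1_def mem_add mem_scale f f0)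
      have "hnorm H (f1 - f0) = t * hnorm H f" using t f by (simp add: f1_def hnorm_scale)
      also have "\<dots> < e" using e pos by (simp add: t_def)
      finally have "f1 \<in> M.mball f0 e" using f0 f1 hnorm_minus_commute[OF f0 f1] by (simp add: M.in_mball d_def)
      then have "cmod (ip H f1 (g i)) \<le> real n" using sub i by (auto simp: E_def)
      moreover have "f0 \<in> E n" using sub f0 e M.centre_in_mball_iff by blast
      then have "cmod (ip H f0 (g i)) \<le> real n" using i by (auto simp: E_def)
      moreover have "ip H f1 (g i) = ip H f0 (g i) + of_real t * ip H f (g i)"
        using f f0 g[OF i] by (simp add: f1_def ip_add ip_scale mem_scale)
      ultimately have "cmod (of_real t * ip H f (g i)) \<le> 2 * real n"
        using norm_triangle_ineq4[of "ip H f1 (g i)" "ip H f0 (g i)"] by simp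
      then have "t * cmod (ip H f (g i)) \<le> 2 * real n" using t by (simp add: norm_mult)
      then show ?thesis using pos e by (simp add: t_def field_simps)
    qed
  qed
qed

end

section \<open>Gram matrices and tensor products of operators\<close>

context hilbert_space
begin

text \<open>
  Gram--Schmidt in matrix form: a Gram matrix is a finite sum of rank one matrices \<open>v v\<^sup>*\<close>. Projecting
  all vectors to the complement of one of them removes one rank one summand.
\<close>
lemma gram_factorization:
  assumes "finite I" "\<And>a. a \<in> I \<Longrightarrow> x a \<in> carr H"
  shows "\<exists>(N::nat) v. \<forall>a\<in>I. \<forall>b\<in>I. ip H (x a) (x b) = (\<Sum>k<N. v k a * cnj (v k b))"
  using assms
proof (induction I arbitrary: x rule: finite_induct)
  case (insert p I)
  \<comment> \<open>For \<open>x p = 0\<close> the convention \<open>1 / 0 = 0\<close> gives \<open>e = 0\<close>, and the projection is the identity.\<close>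
  define e where "e = cscale (of_real (1 / hnorm H (x p))) (x p)"
  define y where "y a = x a - cscale (ip H (x a) e) e" for a
  have x: "x a \<in> carr H" if "a \<in> insert p I" for a using insert.prems that by blast
  have e: "e \<in> carr H" by (simp add: e_def mem_scale x)
  have y: "y a \<in> carr H" if "a \<in> insert p I" for a
    unfolding y_def by (intro mem_diff mem_scale x that e)
  have yp: "y p = 0"
  proof (cases "x p = 0")
    case True
    then show ?thesis by (simp add: y_def e_def)
  next
    case False
    then have n: "hnorm H (x p) \<noteq> 0" using hnorm_eq_0 x by simp
    have "ip H (x p) e = of_real (hnorm H (x p))"
      unfolding e_def using n by (simp add: ip_scale_right x ip_self power2_eq_square)
    then show ?thesis unfolding y_def e_def using n by simp
  qed
  have ee: "ip H (x a) e * ip H e e = ip H (x a) e" if "a \<in> insert p I" for a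
  proof (cases "x p = 0")
    case True
    then show ?thesis using x[OF that] by (simp add: e_def ip_zero_right)
  next
    case False
    then have n: "hnorm H (x p) \<noteq> 0" using hnorm_eq_0 x by simp
    then have "hnorm H e = 1"
      unfolding e_def using hnorm_nonneg[of "x p"] by (simp add: hnorm_scale x norm_divide)
    then show ?thesis by (simp add: ip_self e)
  qed
  have gram: "ip H (x a) (x b) = ip H (y a) (y b) + ip H (x a) e * cnj (ip H (x b) e)"
    if a: "a \<in> insert p I" and b: "b \<in> insert p I" for a b
    using x[OF a] x[OF b] e ee[OF a] ip_commute[OF e x[OF b]]
    by (auto simp: y_def ip_diff ip_diff_right ip_scale ip_scale_right mem_diff mem_scale algebra_simps)
  obtain N :: nat and v where v: "\<And>a b. a \<in> I \<Longrightarrow> b \<in> I \<Longrightarrow> ip H (y a) (y b) = (\<Sum>k<N. v k a * cnj (v k b))"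
  proof -
    have "\<exists>(N::nat) v. \<forall>a\<in>I. \<forall>b\<in>I. ip H (y a) (y b) = (\<Sum>k<N. v k a * cnj (v k b))"
      by (rule insert.IH) (rule y, simp)
    with that show thesis by blast
  qed
  define u where "u k a = (if k = N then ip H (x a) e else if a = p then 0 else v k a)" for k :: nat and a
  have "ip H (x a) (x b) = (\<Sum>k<Suc N. u k a * cnj (u k b))"
    if a: "a \<in> insert p I" and b: "b \<in> insert p I" for a b
  proof -
    have "ip H (y a) (y b) = (\<Sum>k<N. u k a * cnj (u k b))"
    proof (cases "a = p \<or> b = p")
      case True
      then show ?thesis using yp y[OF a] y[OF b] by (auto simp: ip_zero ip_zero_right u_def)
    next
      case False
      then show ?thesis using a b v[of a b] by (auto simp: u_def intro!: sum.cong)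
    qed
    then show ?thesis using gram[OF a b] by (simp add: u_def)
  qed
  then show ?case by blast
qed simp

text \<open>
  The entrywise product of a Gram matrix with a sum of rank one matrices has as total sum a sum of
  squared norms. This is how positivity of entrywise products is used.
\<close>
lemma sum_gram_rank_one:
  assumes "\<And>a. a \<in> I \<Longrightarrow> x a \<in> carr H"
  shows "(\<Sum>a\<in>I. \<Sum>b\<in>I. ip H (x a) (x b) * (\<Sum>k<N. v k a * cnj (v k b)))
    = of_real (\<Sum>k<N. (hnorm H (\<Sum>a\<in>I. cscale (v k a) (x a)))\<^sup>2)"
proof -
  have mem: "(\<Sum>a\<in>I. cscale (v k a) (x a)) \<in> carr H" for k
    using assms by (intro mem_sum mem_scale)
  have one: "of_real ((hnorm H (\<Sum>a\<in>I. cscale (v k a) (x a)))\<^sup>2)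
      = (\<Sum>a\<in>I. \<Sum>b\<in>I. ip H (x a) (x b) * (v k a * cnj (v k b)))" for k
    unfolding ip_self[OF mem, symmetric] using assms mem[of k]
    by (subst ip_sum)
      (auto simp: ip_sum_right mem_scale ip_scale ip_scale_right sum_distrib_left mult_ac
        intro!: sum.cong)
  have "(\<Sum>a\<in>I. \<Sum>b\<in>I. ip H (x a) (x b) * (\<Sum>k<N. v k a * cnj (v k b)))
    = (\<Sum>k<N. \<Sum>a\<in>I. \<Sum>b\<in>I. ip H (x a) (x b) * (v k a * cnj (v k b)))"
    by (simp only: sum_distrib_left sum.swap[of _ "{..<N}" I])
  then show ?thesis unfolding of_real_sum one .
qed

text \<open>
  A bound for \<open>L\<close> is a bound for its adjoint, stated for a single pair \<open>(x, y)\<close> with \<open>L\<^sup>* x = y\<close>, so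
  that the existence of the adjoint is not an issue.
\<close>
lemma adjoint_pair_bound:
  assumes L: "\<And>h. h \<in> carr H \<Longrightarrow> L h \<in> carr H" and bound: "\<And>h. h \<in> carr H \<Longrightarrow> hnorm H (L h) \<le> C * hnorm H h"
    and x: "x \<in> carr H" and y: "y \<in> carr H" and adj: "\<And>h. h \<in> carr H \<Longrightarrow> ip H (L h) x = ip H h y"
  shows "hnorm H y \<le> C * hnorm H x"
proof (cases "hnorm H y = 0")
  case True
  show ?thesis
  proof (cases "hnorm H x = 0")
    case False
    then have "0 < hnorm H x" using hnorm_nonneg[OF x] by simp
    moreover have "0 \<le> C * hnorm H x" using bound[OF x] hnorm_nonneg[OF L[OF x]] by linarith
    ultimately show ?thesis using True by simp
  qed (use True in simp)
next
  case False
  then have pos: "0 < hnorm H y" using hnorm_nonneg[OF y] by simp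
  have "(hnorm H y)\<^sup>2 = cmod (ip H (L y) x)"
    using adj[OF y] ip_self[OF y] by (simp del: of_real_power)
  also have "\<dots> \<le> hnorm H (L y) * hnorm H x" by (rule cauchy_schwarz[OF L[OF y] x])
  also have "\<dots> \<le> C * hnorm H y * hnorm H x"
    by (rule mult_right_mono[OF bound[OF y] hnorm_nonneg[OF x]])
  finally show ?thesis using pos by (simp add: power2_eq_square)
qed

lemma adjoint_family_bound:
  assumes L: "bounded_op H L" and bound: "\<And>h. h \<in> carr H \<Longrightarrow> hnorm H (L h) \<le> C * hnorm H h"
    and x: "\<And>a. a \<in> I \<Longrightarrow> x a \<in> carr H" and y: "\<And>a. a \<in> I \<Longrightarrow> y a \<in> carr H"
    and adj: "\<And>a h. a \<in> I \<Longrightarrow> h \<in> carr H \<Longrightarrow> ip H (L h) (x a) = ip H h (y a)"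
  shows "hnorm H (\<Sum>a\<in>I. cscale (c a) (y a)) \<le> C * hnorm H (\<Sum>a\<in>I. cscale (c a) (x a))"
proof (rule adjoint_pair_bound)
  show "L h \<in> carr H" if "h \<in> carr H" for h using L that by (auto simp: bounded_op_def)
  show "hnorm H (L h) \<le> C * hnorm H h" if "h \<in> carr H" for h using bound that .
  show "(\<Sum>a\<in>I. cscale (c a) (x a)) \<in> carr H" using x by (intro mem_sum mem_scale)
  show "(\<Sum>a\<in>I. cscale (c a) (y a)) \<in> carr H" using y by (intro mem_sum mem_scale)
  fix h assume h: "h \<in> carr H"
  then have "L h \<in> carr H" using L by (auto simp: bounded_op_def)
  then show "ip H (L h) (\<Sum>a\<in>I. cscale (c a) (x a)) = ip H h (\<Sum>a\<in>I. cscale (c a) (y a))"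
    using x y adj h by (simp add: ip_sum_right mem_scale ip_scale_right)
qed

end

text \<open>
  The operator \<open>x a \<otimes> y a \<mapsto> x' a \<otimes> y' a\<close> has norm at most \<open>C1 C2\<close> on the span of elementary tensors.
  It is a composition of two operators, each acting on one factor. In each step the Gram matrix of
  the factor that stays fixed is split into rank one matrices, which reduces the claim to norms in
  the other factor.
\<close>
lemma tensor_contraction:
  assumes H1: "hilbert_space H1" and H2: "hilbert_space H2" and fin: "finite I"
    and x: "\<And>a. a \<in> I \<Longrightarrow> x a \<in> carr H1" and x': "\<And>a. a \<in> I \<Longrightarrow> x' a \<in> carr H1"
    and y: "\<And>a. a \<in> I \<Longrightarrow> y a \<in> carr H2" and y': "\<And>a. a \<in> I \<Longrightarrow> y' a \<in> carr H2"
    and c1: "\<And>c. hnorm H1 (\<Sum>a\<in>I. cscale (c a) (x' a)) \<le> C1 * hnorm H1 (\<Sum>a\<in>I. cscale (c a) (x a))"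
    and c2: "\<And>c. hnorm H2 (\<Sum>a\<in>I. cscale (c a) (y' a)) \<le> C2 * hnorm H2 (\<Sum>a\<in>I. cscale (c a) (y a))"
  shows "Re (\<Sum>a\<in>I. \<Sum>b\<in>I. ip H1 (x' a) (x' b) * ip H2 (y' a) (y' b))
    \<le> (C1 * C2)\<^sup>2 * Re (\<Sum>a\<in>I. \<Sum>b\<in>I. ip H1 (x a) (x b) * ip H2 (y a) (y b))"
proof -
  interpret H1: hilbert_space H1 by fact
  interpret H2: hilbert_space H2 by fact
  obtain N v where v: "\<And>a b. a \<in> I \<Longrightarrow> b \<in> I \<Longrightarrow> ip H2 (y' a) (y' b) = (\<Sum>k<(N::nat). v k a * cnj (v k b))"
    using H2.gram_factorization[OF fin, of y'] y' by blast
  obtain M u where u: "\<And>a b. a \<in> I \<Longrightarrow> b \<in> I \<Longrightarrow> ip H1 (x a) (x b) = (\<Sum>k<(M::nat). u k a * cnj (u k b))"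
    using H1.gram_factorization[OF fin, of x] x by blast
  have sq: "s\<^sup>2 \<le> C\<^sup>2 * t\<^sup>2" if "s \<le> C * t" "0 \<le> s" for s t C :: real
    using power_mono[OF that, of 2] by (simp add: power_mult_distrib)
  have "Re (\<Sum>a\<in>I. \<Sum>b\<in>I. ip H1 (x' a) (x' b) * ip H2 (y' a) (y' b))
      = (\<Sum>k<N. (hnorm H1 (\<Sum>a\<in>I. cscale (v k a) (x' a)))\<^sup>2)"
    using H1.sum_gram_rank_one[of I x' v N] x' v by simp
  also have "\<dots> \<le> (\<Sum>k<N. C1\<^sup>2 * (hnorm H1 (\<Sum>a\<in>I. cscale (v k a) (x a)))\<^sup>2)"
    by (intro sum_mono sq c1 H1.hnorm_nonneg H1.mem_sum H1.mem_scale x')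
  also have "\<dots> = C1\<^sup>2 * Re (\<Sum>a\<in>I. \<Sum>b\<in>I. ip H1 (x a) (x b) * ip H2 (y' a) (y' b))"
    using H1.sum_gram_rank_one[of I x v N] x v by (simp add: sum_distrib_left)
  also have "(\<Sum>a\<in>I. \<Sum>b\<in>I. ip H1 (x a) (x b) * ip H2 (y' a) (y' b))
      = of_real (\<Sum>k<M. (hnorm H2 (\<Sum>a\<in>I. cscale (u k a) (y' a)))\<^sup>2)"
    using H2.sum_gram_rank_one[of I y' u M] y' u by (simp add: mult.commute)
  also have "C1\<^sup>2 * Re (of_real (\<Sum>k<M. (hnorm H2 (\<Sum>a\<in>I. cscale (u k a) (y' a)))\<^sup>2))
      \<le> C1\<^sup>2 * (\<Sum>k<M. C2\<^sup>2 * (hnorm H2 (\<Sum>a\<in>I. cscale (u k a) (y a)))\<^sup>2)"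
    unfolding Re_complex_of_real
    by (intro mult_left_mono sum_mono sq c2 H2.hnorm_nonneg H2.mem_sum H2.mem_scale y') simp_all
  also have "\<dots> = (C1 * C2)\<^sup>2 * Re (\<Sum>a\<in>I. \<Sum>b\<in>I. ip H1 (x a) (x b) * ip H2 (y a) (y b))"
    using H2.sum_gram_rank_one[of I y u M] y u
    by (simp add: sum_distrib_left mult_ac power_mult_distrib)
  finally show ?thesis .
qed

section \<open>Multiplication operators and their functional calculus\<close>

context hilbert_space
begin

lemma bounded_op_cong:
  assumes "bounded_op H T" "\<And>f. f \<in> carr H \<Longrightarrow> T f = T' f"
  shows "bounded_op H T'"
  using assms unfolding bounded_op_def by (simp add: mem_add mem_scale)

end

definition mult_fun :: "(complex \<Rightarrow> complex) \<Rightarrow> vfun \<Rightarrow> vfun" where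
  "mult_fun a f = (\<lambda>z i. a z * f z i)"

lemma mult_z_eq_mult_fun: "mult_z = mult_fun (\<lambda>z. z)"
  by (simp add: mult_z_def mult_fun_def fun_eq_iff)

context rkhs
begin

text \<open>
  The kernel sections in the coordinate directions represent the evaluation of single components.
\<close>
lemma ip_coordinate:
  assumes "f \<in> carr H" "w \<in> ball 0 1" "i < k"
  shows "ip H f (kernel_section k K w (\<lambda>j. if j = i then 1 else 0)) = f w i"
proof -
  have "(\<Sum>j<k. f w j * cnj (if j = i then 1 else 0)) = (\<Sum>j<k. if j = i then f w j else 0)"
    by (intro sum.cong) auto
  then show ?thesis using assms by (simp add: reproducing del: mem_ball mem_ball_0)
qed

lemma vfun_eqI:
  assumes "f \<in> carr H" "g \<in> carr H" "\<And>z i. z \<in> ball 0 1 \<Longrightarrow> i < k \<Longrightarrow> f z i = g z i"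
  shows "f = g"
proof (intro ext)
  fix z i
  show "f z i = g z i"
    using assms(3)[of z i] extensional[OF assms(1), of z i] extensional[OF assms(2), of z i]
    by (cases "z \<in> ball 0 1 \<and> i < k") (metis not_le)+
qed

lemma mult_fun_resolvent_left:
  assumes "\<zeta> \<notin> ball 0 1" "f \<in> carr H"
  shows "mult_fun (\<lambda>z. 1 / (\<zeta> - z)) (cscale \<zeta> f - mult_z f) = f"
proof (intro ext)
  fix z i
  show "mult_fun (\<lambda>z. 1 / (\<zeta> - z)) (cscale \<zeta> f - mult_z f) z i = f z i"
  proof (cases "z \<in> ball 0 1")
    case True
    then have "\<zeta> - z \<noteq> 0" using assms by auto
    then show ?thesis
      by (simp add: mult_fun_def mult_z_def cscale_def fun_diff_def field_simps)
  next
    case False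
    then show ?thesis using extensional[OF assms(2)]
      by (simp add: mult_fun_def mult_z_def cscale_def fun_diff_def)
  qed
qed

lemma mult_fun_resolvent_right:
  assumes "\<zeta> \<notin> ball 0 1" "f \<in> carr H"
  shows "cscale \<zeta> (mult_fun (\<lambda>z. 1 / (\<zeta> - z)) f) - mult_z (mult_fun (\<lambda>z. 1 / (\<zeta> - z)) f) = f"
proof (intro ext)
  fix z i
  show "(cscale \<zeta> (mult_fun (\<lambda>z. 1 / (\<zeta> - z)) f) - mult_z (mult_fun (\<lambda>z. 1 / (\<zeta> - z)) f)) z i = f z i"
  proof (cases "z \<in> ball 0 1")
    case True
    then have "\<zeta> - z \<noteq> 0" using assms by auto
    then show ?thesis
      by (simp add: mult_fun_def mult_z_def cscale_def fun_diff_def flip: diff_divide_distrib left_diff_distrib)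
  next
    case False
    then show ?thesis using extensional[OF assms(2)]
      by (simp add: mult_fun_def mult_z_def cscale_def fun_diff_def)
  qed
qed

text \<open>
  The resolvent at \<open>f\<close> solves \<open>(\<zeta> - z) h(z) = f(z)\<close> pointwise, and \<open>\<zeta> - z\<close> has no zero in the disc.
\<close>
lemma resolvent_eq_mult_fun:
  assumes inv: "invertible_op H (\<lambda>f. cscale \<zeta> f - mult_z f)" and \<zeta>: "\<zeta> \<notin> ball 0 1" and f: "f \<in> carr H"
  shows "resolvent H mult_z \<zeta> f = mult_fun (\<lambda>z. 1 / (\<zeta> - z)) f"
proof -
  have bij: "bij_betw (\<lambda>f. cscale \<zeta> f - mult_z f) (carr H) (carr H)"
    using inv by (simp add: invertible_op_def)
  then have g: "resolvent H mult_z \<zeta> f \<in> carr H"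
    and eq: "cscale \<zeta> (resolvent H mult_z \<zeta> f) - mult_z (resolvent H mult_z \<zeta> f) = f"
    unfolding resolvent_def
    using inv_into_into[of f "\<lambda>f. cscale \<zeta> f - mult_z f" "carr H"]
      bij_betw_inv_into_right[OF bij f] bij_betw_imp_surj_on[OF bij] f by auto
  show ?thesis using mult_fun_resolvent_left[OF \<zeta> g] unfolding eq by (rule sym)
qed

lemma bounded_resolvent_mult_fun:
  assumes "op_spectrum H mult_z \<subseteq> cball 0 1" and "1 < cmod \<zeta>"
  shows "bounded_op H (mult_fun (\<lambda>z. 1 / (\<zeta> - z)))"
    and "f \<in> carr H \<Longrightarrow> resolvent H mult_z \<zeta> f = mult_fun (\<lambda>z. 1 / (\<zeta> - z)) f"
proof -
  have \<zeta>: "\<zeta> \<notin> ball 0 1" using assms by simp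
  have inv: "invertible_op H (\<lambda>f. cscale \<zeta> f - mult_z f)"
    using assms by (force simp: op_spectrum_def)
  show res: "resolvent H mult_z \<zeta> f = mult_fun (\<lambda>z. 1 / (\<zeta> - z)) f" if "f \<in> carr H" for f
    by (rule resolvent_eq_mult_fun[OF inv \<zeta> that])
  have "bounded_op H (resolvent H mult_z \<zeta>)"
    using inv by (simp add: invertible_op_def resolvent_def)
  then show "bounded_op H (mult_fun (\<lambda>z. 1 / (\<zeta> - z)))"
    using res by (rule bounded_op_cong)
qed

lemma invertible_resolvent:
  assumes M: "bounded_op H mult_z" and R: "bounded_op H (mult_fun (\<lambda>z. 1 / (\<zeta> - z)))"
    and \<zeta>: "\<zeta> \<notin> ball 0 1"
  shows "invertible_op H (\<lambda>f. cscale \<zeta> f - mult_z f)"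
proof -
  let ?T = "\<lambda>f. cscale \<zeta> f - mult_z f" and ?R = "mult_fun (\<lambda>z. 1 / (\<zeta> - z))"
  have memM: "mult_z f \<in> carr H" if "f \<in> carr H" for f using M that by (simp add: bounded_op_def)
  have memR: "?R f \<in> carr H" if "f \<in> carr H" for f using R that by (simp add: bounded_op_def)
  have memT: "?T f \<in> carr H" if "f \<in> carr H" for f using that by (intro mem_diff mem_scale memM)
  have bij: "bij_betw ?T (carr H) (carr H)"
  proof (rule bij_betw_byWitness[where f' = ?R])
    show "\<forall>f\<in>carr H. ?R (?T f) = f" using mult_fun_resolvent_left[OF \<zeta>] by blast
    show "\<forall>f\<in>carr H. ?T (?R f) = f" using mult_fun_resolvent_right[OF \<zeta>] by blast
    show "?T ` carr H \<subseteq> carr H" using memT by blast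
    show "?R ` carr H \<subseteq> carr H" using memR by blast
  qed
  have inv: "?R f = inv_into (carr H) ?T f" if "f \<in> carr H" for f
    using inv_into_f_eq[OF bij_betw_imp_inj_on[OF bij] memR[OF that]]
      mult_fun_resolvent_right[OF \<zeta> that] by simp
  obtain C where C: "\<And>f. f \<in> carr H \<Longrightarrow> hnorm H (mult_z f) \<le> C * hnorm H f"
    using M unfolding bounded_op_def by blast
  have "bounded_op H ?T"
    unfolding bounded_op_def
  proof (intro conjI ballI allI)
    show "?T (f + g) = ?T f + ?T g" for f g
      by (simp add: fun_eq_iff mult_z_def cscale_def vminus_apply algebra_simps)
    show "?T (cscale c f) = cscale c (?T f)" for c f
      by (simp add: fun_eq_iff mult_z_def cscale_def vminus_apply algebra_simps)
    have "hnorm H (?T f) \<le> (cmod \<zeta> + C) * hnorm H f" if f: "f \<in> carr H" for f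
      using hnorm_diff_le[OF mem_scale[OF f, of \<zeta>] memM[OF f]] C[OF f] hnorm_scale[OF f, of \<zeta>]
      by (simp add: distrib_right)
    then show "\<exists>C. \<forall>f\<in>carr H. hnorm H (?T f) \<le> C * hnorm H f" by blast
  qed (rule memT)
  moreover have "bounded_op H (inv_into (carr H) ?T)" using R inv by (rule bounded_op_cong)
  ultimately show ?thesis using bij by (simp add: invertible_op_def)
qed

text \<open>
  Pairing with a kernel section turns the weak integral into the scalar Cauchy formula at \<open>w\<close>.
\<close>
lemma disc_calculus_apply:
  assumes spec: "op_spectrum H mult_z \<subseteq> cball 0 1" and A: "disc_calculus H mult_z \<phi> A"
    and f: "f \<in> carr H" and w: "w \<in> ball 0 1" and i: "i < k"
  shows "A f w i = \<phi> w * f w i"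
proof -
  obtain r F where r: "1 < r" and F: "F analytic_on cball 0 r" "\<And>z. z \<in> ball 0 1 \<Longrightarrow> F z = \<phi> z"
    and eq: "\<And>g. g \<in> carr H \<Longrightarrow> ip H (A f) g =
       contour_integral (circlepath 0 r) (\<lambda>\<zeta>. F \<zeta> * ip H (resolvent H mult_z \<zeta> f) g) / (2 * of_real pi * \<i>)"
    using A f unfolding disc_calculus_def by blast
  have Af: "A f \<in> carr H" using A f by (simp add: disc_calculus_def bounded_op_def)
  let ?g = "kernel_section k K w (\<lambda>j. if j = i then 1 else 0)"
  have res: "ip H (resolvent H mult_z \<zeta> f) ?g = f w i / (\<zeta> - w)" if "\<zeta> \<in> path_image (circlepath 0 r)" for \<zeta>
  proof -
    have \<zeta>: "1 < cmod \<zeta>" using that r by auto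
    have "mult_fun (\<lambda>z. 1 / (\<zeta> - z)) f \<in> carr H"
      using bounded_resolvent_mult_fun(1)[OF spec \<zeta>] f by (simp add: bounded_op_def)
    from ip_coordinate[OF this w i] show ?thesis
      unfolding bounded_resolvent_mult_fun(2)[OF spec \<zeta> f] by (simp add: mult_fun_def)
  qed
  have "A f w i = ip H (A f) ?g" using ip_coordinate[OF Af w i] by simp
  also have "\<dots> = contour_integral (circlepath 0 r) (\<lambda>\<zeta>. F \<zeta> * ip H (resolvent H mult_z \<zeta> f) ?g)
      / (2 * of_real pi * \<i>)" by (rule eq[OF section_mem[OF w]])
  also have "contour_integral (circlepath 0 r) (\<lambda>\<zeta>. F \<zeta> * ip H (resolvent H mult_z \<zeta> f) ?g)
      = contour_integral (circlepath 0 r) (\<lambda>\<zeta>. F \<zeta> / (\<zeta> - w) * f w i)"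
    by (rule contour_integral_eq) (simp add: res)
  also have "\<dots> = 2 * of_real pi * \<i> * F w * f w i"
  proof (rule contour_integral_unique, rule has_contour_integral_rmul, rule Cauchy_integral_circlepath_simple)
    show "F holomorphic_on cball 0 r" using F(1) by (rule analytic_imp_holomorphic)
    show "cmod (w - 0) < r" using w r by simp
  qed
  finally show ?thesis using F(2)[OF w] by simp
qed

text \<open>
  The weak integral is a bounded functional of \<open>g\<close>, so it is \<open>\<langle>u, g\<rangle>\<close> for some \<open>u\<close> in the space. Taking
  kernel sections for \<open>g\<close>, the Cauchy formula shows that \<open>u = \<phi> f\<close>. The functional is bounded because
  \<open>\<zeta> \<mapsto> (\<zeta> - M\<^sub>z)\<^sup>-\<^sup>1 f\<close> is norm continuous on the circle, by the resolvent identity.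
\<close>
lemma disc_calculus_mult_fun:
  assumes M: "bounded_op H mult_z"
    and R: "\<And>\<zeta>. 1 < cmod \<zeta> \<Longrightarrow> bounded_op H (mult_fun (\<lambda>z. 1 / (\<zeta> - z)))"
    and r: "1 < r" and F: "F analytic_on cball 0 r" "\<And>z. z \<in> ball 0 1 \<Longrightarrow> F z = \<phi> z"
    and A: "bounded_op H (mult_fun \<phi>)"
  shows "disc_calculus H mult_z \<phi> (mult_fun \<phi>)"
proof -
  define Q where "Q \<zeta> = mult_fun (\<lambda>z. 1 / (\<zeta> - z))" for \<zeta>
  have memQ: "Q \<zeta> f \<in> carr H" if "f \<in> carr H" "1 < cmod \<zeta>" for \<zeta> f
    using R that by (simp add: bounded_op_def Q_def)
  have resolvent: "resolvent H mult_z \<zeta> f = Q \<zeta> f" if "f \<in> carr H" "1 < cmod \<zeta>" for \<zeta> f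
    unfolding Q_def using that resolvent_eq_mult_fun[OF invertible_resolvent[OF M R]] by simp
  have Qdiff: "Q \<zeta> f - Q \<zeta>' f = cscale (\<zeta>' - \<zeta>) (Q \<zeta>' (Q \<zeta> f))"
    if f: "f \<in> carr H" and \<zeta>: "1 < cmod \<zeta>" "1 < cmod \<zeta>'" for \<zeta> \<zeta>' f
  proof (rule vfun_eqI)
    show "Q \<zeta> f - Q \<zeta>' f \<in> carr H" "cscale (\<zeta>' - \<zeta>) (Q \<zeta>' (Q \<zeta> f)) \<in> carr H"
      by (intro mem_diff mem_scale memQ f \<zeta>)+
    fix z i assume z: "z \<in> ball (0::complex) 1"
    have "\<zeta> - z \<noteq> 0" "\<zeta>' - z \<noteq> 0" using z \<zeta> by auto
    then show "(Q \<zeta> f - Q \<zeta>' f) z i = cscale (\<zeta>' - \<zeta>) (Q \<zeta>' (Q \<zeta> f)) z i"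
      by (simp add: Q_def mult_fun_def cscale_def vminus_apply divide_simps) (simp add: algebra_simps)
  qed
  have calc: "ip H (mult_fun \<phi> f) g =
      contour_integral (circlepath 0 r) (\<lambda>\<zeta>. F \<zeta> * ip H (resolvent H mult_z \<zeta> f) g) / (2 * of_real pi * \<i>)"
    if f: "f \<in> carr H" and g: "g \<in> carr H" for f g
  proof -
    let ?S = "sphere (0::complex) r"
    have S: "1 < cmod \<zeta>" if "\<zeta> \<in> ?S" for \<zeta> using that r by simp
    have Qcont: "((\<lambda>\<zeta>. hnorm H (Q \<zeta> f - Q \<zeta>0 f)) \<longlongrightarrow> 0) (at \<zeta>0 within ?S)" if \<zeta>0: "\<zeta>0 \<in> ?S" for \<zeta>0
    proof -
      obtain C' where "\<And>h. h \<in> carr H \<Longrightarrow> hnorm H (Q \<zeta>0 h) \<le> C' * hnorm H h"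
        using R[OF S[OF \<zeta>0]] unfolding Q_def bounded_op_def by blast
      then have C: "\<And>h. h \<in> carr H \<Longrightarrow> hnorm H (Q \<zeta>0 h) \<le> (\<bar>C'\<bar> + 1) * hnorm H h"
        by (smt (verit) hnorm_nonneg mult_right_mono)
      define C where "C = \<bar>C'\<bar> + 1"
      have C0: "0 < C" by (simp add: C_def)
      have diff: "hnorm H (Q \<zeta> f - Q \<zeta>0 f) \<le> dist \<zeta> \<zeta>0 * C * hnorm H (Q \<zeta> f)" if "\<zeta> \<in> ?S" for \<zeta>
        using mult_left_mono[OF C[OF memQ[OF f S[OF that]]], of "dist \<zeta> \<zeta>0"]
        unfolding Qdiff[OF f S[OF that] S[OF \<zeta>0]]
          hnorm_scale[OF memQ[OF memQ[OF f S[OF that]] S[OF \<zeta>0]]] C_def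
        by (simp add: dist_norm norm_minus_commute mult.assoc)
      \<comment> \<open>A local bound for \<open>(\<zeta> - M\<^sub>z)\<^sup>-\<^sup>1 f\<close>: for \<open>\<zeta>\<close> close to \<open>\<zeta>0\<close> the error term in the resolvent identity
        absorbs half of the norm.\<close>
      have bnd: "hnorm H (Q \<zeta> f) \<le> 2 * hnorm H (Q \<zeta>0 f)" if \<zeta>: "\<zeta> \<in> ?S" and d: "dist \<zeta> \<zeta>0 < 1 / (2 * C)" for \<zeta>
      proof -
        have "dist \<zeta> \<zeta>0 * C \<le> 1 / 2" using d C0 by (simp add: field_simps)
        then have "dist \<zeta> \<zeta>0 * C * hnorm H (Q \<zeta> f) \<le> 1 / 2 * hnorm H (Q \<zeta> f)"
          by (rule mult_right_mono[OF _ hnorm_nonneg[OF memQ[OF f S[OF \<zeta>]]]])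
        then show ?thesis
          using hnorm_le_add_diff[OF memQ[OF f S[OF \<zeta>]] memQ[OF f S[OF \<zeta>0]]] diff[OF \<zeta>] by linarith
      qed
      show ?thesis
      proof (rule Lim_null_comparison)
        show "\<forall>\<^sub>F \<zeta> in at \<zeta>0 within ?S. norm (hnorm H (Q \<zeta> f - Q \<zeta>0 f)) \<le> dist \<zeta> \<zeta>0 * C * (2 * hnorm H (Q \<zeta>0 f))"
          unfolding eventually_at
        proof (intro exI[of _ "1 / (2 * C)"] conjI ballI impI)
          fix \<zeta> assume \<zeta>: "\<zeta> \<in> ?S" and d: "\<zeta> \<noteq> \<zeta>0 \<and> dist \<zeta> \<zeta>0 < 1 / (2 * C)"
          have "dist \<zeta> \<zeta>0 * C * hnorm H (Q \<zeta> f) \<le> dist \<zeta> \<zeta>0 * C * (2 * hnorm H (Q \<zeta>0 f))"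
            using bnd[OF \<zeta>] d C0 by (intro mult_left_mono) auto
          then show "norm (hnorm H (Q \<zeta> f - Q \<zeta>0 f)) \<le> dist \<zeta> \<zeta>0 * C * (2 * hnorm H (Q \<zeta>0 f))"
            using diff[OF \<zeta>] hnorm_nonneg[OF mem_diff[OF memQ[OF f S[OF \<zeta>]] memQ[OF f S[OF \<zeta>0]]]] by simp
        qed (use C0 in simp)
        have "((\<lambda>\<zeta>. dist \<zeta> \<zeta>0 * C * (2 * hnorm H (Q \<zeta>0 f))) \<longlongrightarrow> dist \<zeta>0 \<zeta>0 * C * (2 * hnorm H (Q \<zeta>0 f)))
            (at \<zeta>0 within ?S)" by (intro tendsto_intros)
        then show "((\<lambda>\<zeta>. dist \<zeta> \<zeta>0 * C * (2 * hnorm H (Q \<zeta>0 f))) \<longlongrightarrow> 0) (at \<zeta>0 within ?S)" by simp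
      qed
    qed
    have ipcont: "continuous_on ?S (\<lambda>\<zeta>. ip H (Q \<zeta> f) h)" if h: "h \<in> carr H" for h
      unfolding continuous_on_def
    proof
      fix \<zeta>0 assume \<zeta>0: "\<zeta>0 \<in> ?S"
      have "((\<lambda>\<zeta>. ip H (Q \<zeta> f) h - ip H (Q \<zeta>0 f) h) \<longlongrightarrow> 0) (at \<zeta>0 within ?S)"
      proof (rule Lim_null_comparison)
        show "\<forall>\<^sub>F \<zeta> in at \<zeta>0 within ?S. norm (ip H (Q \<zeta> f) h - ip H (Q \<zeta>0 f) h)
            \<le> hnorm H (Q \<zeta> f - Q \<zeta>0 f) * hnorm H h"
          unfolding eventually_at
        proof (intro exI[of _ 1] conjI ballI impI)
          fix \<zeta> assume "\<zeta> \<in> ?S"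
          then show "norm (ip H (Q \<zeta> f) h - ip H (Q \<zeta>0 f) h) \<le> hnorm H (Q \<zeta> f - Q \<zeta>0 f) * hnorm H h"
            using cauchy_schwarz[OF mem_diff[OF memQ[OF f S] memQ[OF f S]] h, of \<zeta> \<zeta>0]
              ip_diff[OF memQ[OF f S] memQ[OF f S] h, of \<zeta> \<zeta>0] \<zeta>0 by metis
        qed simp
        show "((\<lambda>\<zeta>. hnorm H (Q \<zeta> f - Q \<zeta>0 f) * hnorm H h) \<longlongrightarrow> 0) (at \<zeta>0 within ?S)"
          using tendsto_mult_right[OF Qcont[OF \<zeta>0], of "hnorm H h"] by simp
      qed
      then show "((\<lambda>\<zeta>. ip H (Q \<zeta> f) h) \<longlongrightarrow> ip H (Q \<zeta>0 f) h) (at \<zeta>0 within ?S)"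
        by (simp add: LIM_zero_iff)
    qed
    have "continuous_on ?S (\<lambda>\<zeta>. hnorm H (Q \<zeta> f))"
      unfolding continuous_on_def
    proof
      fix \<zeta>0 assume \<zeta>0: "\<zeta>0 \<in> ?S"
      have "((\<lambda>\<zeta>. hnorm H (Q \<zeta> f) - hnorm H (Q \<zeta>0 f)) \<longlongrightarrow> 0) (at \<zeta>0 within ?S)"
      proof (rule Lim_null_comparison[OF _ Qcont[OF \<zeta>0]])
        show "\<forall>\<^sub>F \<zeta> in at \<zeta>0 within ?S. norm (hnorm H (Q \<zeta> f) - hnorm H (Q \<zeta>0 f)) \<le> hnorm H (Q \<zeta> f - Q \<zeta>0 f)"
          unfolding eventually_at
        proof (intro exI[of _ 1] conjI ballI impI)
          fix \<zeta> assume \<zeta>: "\<zeta> \<in> ?S"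
          note m = memQ[OF f S[OF \<zeta>]] memQ[OF f S[OF \<zeta>0]]
          show "norm (hnorm H (Q \<zeta> f) - hnorm H (Q \<zeta>0 f)) \<le> hnorm H (Q \<zeta> f - Q \<zeta>0 f)"
            using hnorm_le_add_diff[OF m] hnorm_le_add_diff[OF m(2,1)] hnorm_minus_commute[OF m] by simp
        qed simp
      qed
      then show "((\<lambda>\<zeta>. hnorm H (Q \<zeta> f)) \<longlongrightarrow> hnorm H (Q \<zeta>0 f)) (at \<zeta>0 within ?S)"
        by (simp add: LIM_zero_iff)
    qed
    then have "compact ((\<lambda>\<zeta>. hnorm H (Q \<zeta> f)) ` ?S)" by (intro compact_continuous_image) auto
    then have bdd: "bdd_above ((\<lambda>\<zeta>. hnorm H (Q \<zeta> f)) ` ?S)"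
      by (intro bounded_imp_bdd_above compact_imp_bounded)
    define B where "B = (SUP \<zeta>\<in>?S. hnorm H (Q \<zeta> f))"
    have B: "hnorm H (Q \<zeta> f) \<le> B" if "\<zeta> \<in> ?S" for \<zeta>
      unfolding B_def using that bdd by (rule cSUP_upper)
    have Fcont: "continuous_on ?S F"
      by (rule continuous_on_subset[OF holomorphic_on_imp_continuous_on[OF analytic_imp_holomorphic[OF F(1)]]])
        auto
    then have "compact ((\<lambda>\<zeta>. cmod (F \<zeta>)) ` ?S)"
      by (intro compact_continuous_image continuous_on_norm) auto
    then have bdd: "bdd_above ((\<lambda>\<zeta>. cmod (F \<zeta>)) ` ?S)"
      by (intro bounded_imp_bdd_above compact_imp_bounded)
    define D where "D = (SUP \<zeta>\<in>?S. cmod (F \<zeta>))"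
    have D: "cmod (F \<zeta>) \<le> D" if "\<zeta> \<in> ?S" for \<zeta>
      unfolding D_def using that bdd by (rule cSUP_upper)
    obtain \<zeta>1 where \<zeta>1: "\<zeta>1 \<in> ?S" by (rule that[of "of_real r"]) (use r in simp)
    have D0: "0 \<le> D" using D[OF \<zeta>1] norm_ge_zero[of "F \<zeta>1"] by linarith
    have B0: "0 \<le> B" using B[OF \<zeta>1] hnorm_nonneg[OF memQ[OF f S[OF \<zeta>1]]] by linarith
    define c where "c = 2 * complex_of_real pi * \<i>"
    define I where "I h = contour_integral (circlepath 0 r) (\<lambda>\<zeta>. F \<zeta> * ip H (Q \<zeta> f) h)" for h
    have int: "(\<lambda>\<zeta>. F \<zeta> * ip H (Q \<zeta> f) h) contour_integrable_on circlepath 0 r" if "h \<in> carr H" for h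
      using r by (intro contour_integrable_continuous_circlepath continuous_intros)
        (use Fcont ipcont[OF that] in simp_all)
    have bound: "cmod (I h) \<le> D * B * 2 * pi * r * hnorm H h" if h: "h \<in> carr H" for h
    proof -
      have "cmod (I h) \<le> (D * (B * hnorm H h)) * (2 * pi * r)"
        unfolding I_def
      proof (rule has_contour_integral_bound_circlepath[OF has_contour_integral_integral[OF int[OF h]]])
        fix \<zeta> assume "cmod (\<zeta> - 0) = r"
        then have \<zeta>: "\<zeta> \<in> ?S" by simp
        have "cmod (ip H (Q \<zeta> f) h) \<le> B * hnorm H h"
          using cauchy_schwarz[OF memQ[OF f S[OF \<zeta>]] h] mult_right_mono[OF B[OF \<zeta>] hnorm_nonneg[OF h]]
          by linarith
        then show "cmod (F \<zeta> * ip H (Q \<zeta> f) h) \<le> D * (B * hnorm H h)"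
          unfolding norm_mult by (intro mult_mono D \<zeta> D0) auto
      qed (use r D0 B0 hnorm_nonneg[OF h] in auto)
      then show ?thesis by (simp add: mult_ac)
    qed
    \<comment> \<open>The functional \<open>I\<close> is conjugate linear, so its conjugate is the one to be represented.\<close>
    let ?R = "(\<lambda>h. (h, cnj (I h / c))) ` carr H"
    have sub: "path_image (circlepath 0 r) = ?S" using r by simp
    have Smem: "\<zeta> \<in> path_image (circlepath 0 r) \<Longrightarrow> 1 < cmod \<zeta>" for \<zeta>
      using S unfolding sub .
    have Iadd: "I (h + h') = I h + I h'" if "h \<in> carr H" "h' \<in> carr H" for h h'
    proof -
      have "I (h + h') = contour_integral (circlepath 0 r)
          (\<lambda>\<zeta>. F \<zeta> * ip H (Q \<zeta> f) h + F \<zeta> * ip H (Q \<zeta> f) h')"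
        unfolding I_def
        by (rule contour_integral_eq) (simp only: ip_add_right[OF memQ[OF f Smem] that] distrib_left)
      then show ?thesis unfolding I_def using contour_integral_add[OF int int] that by simp
    qed
    have Iscale: "I (cscale s h) = cnj s * I h" if "h \<in> carr H" for s h
    proof -
      have "I (cscale s h) = contour_integral (circlepath 0 r) (\<lambda>\<zeta>. cnj s * (F \<zeta> * ip H (Q \<zeta> f) h))"
        unfolding I_def
        by (rule contour_integral_eq) (simp only: ip_scale_right[OF memQ[OF f Smem] that] mult_ac)
      then show ?thesis unfolding I_def using contour_integral_lmul[OF int[OF that]] by simp
    qed
    obtain u where u: "u \<in> carr H" and rep: "\<And>h s. (h, s) \<in> ?R \<Longrightarrow> ip H h u = s"
    proof (rule riesz_relation[of ?R "D * B * 2 * pi * r / cmod c"])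
      show "cmod s \<le> D * B * 2 * pi * r / cmod c * hnorm H h" if "(h, s) \<in> ?R" for h s
        using that bound by (auto simp: norm_divide divide_right_mono)
      show "?R \<noteq> {}" using mem_0 by blast
      show "(h + h', s + s') \<in> ?R" if "(h, s) \<in> ?R" "(h', s') \<in> ?R" for h s h' s'
        using that Iadd mem_add by (auto simp: image_iff add_divide_distrib)
      show "(cscale t h, t * s) \<in> ?R" if "(h, s) \<in> ?R" for h s t
        using that Iscale mem_scale by (auto simp: image_iff)
      show "0 \<le> D * B * 2 * pi * r / cmod c" using D0 B0 r by simp
    qed auto
    have uip: "ip H u h = I h / c" if "h \<in> carr H" for h
    proof -
      have "(h, cnj (I h / c)) \<in> ?R" using that by blast
      then have "ip H h u = cnj (I h / c)" by (rule rep)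
      then show ?thesis using ip_commute[OF u that] by simp
    qed
    have mem: "mult_fun \<phi> f \<in> carr H" using A f by (simp add: bounded_op_def)
    have "u = mult_fun \<phi> f"
    proof (rule vfun_eqI[OF u mem])
      fix w i assume w: "w \<in> ball (0::complex) 1" and i: "i < k"
      let ?g = "kernel_section k K w (\<lambda>j. if j = i then 1 else 0)"
      have "u w i = I ?g / c" using uip[OF section_mem[OF w]] ip_coordinate[OF u w i] by simp
      also have "I ?g = contour_integral (circlepath 0 r) (\<lambda>\<zeta>. F \<zeta> / (\<zeta> - w) * f w i)"
        unfolding I_def
      proof (rule contour_integral_eq)
        fix \<zeta> assume "\<zeta> \<in> path_image (circlepath 0 r)"
        then have "1 < cmod \<zeta>" by (rule Smem)
        from ip_coordinate[OF memQ[OF f this] w i]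
        show "F \<zeta> * ip H (Q \<zeta> f) ?g = F \<zeta> / (\<zeta> - w) * f w i" by (simp add: Q_def mult_fun_def)
      qed
      also have "\<dots> = c * F w * f w i"
        unfolding c_def
      proof (rule contour_integral_unique, rule has_contour_integral_rmul, rule Cauchy_integral_circlepath_simple)
        show "F holomorphic_on cball 0 r" using F(1) by (rule analytic_imp_holomorphic)
        show "cmod (w - 0) < r" using w r by simp
      qed
      finally show "u w i = mult_fun \<phi> f w i" using F(2)[OF w] by (simp add: c_def mult_fun_def)
    qed
    moreover have "I g = contour_integral (circlepath 0 r) (\<lambda>\<zeta>. F \<zeta> * ip H (resolvent H mult_z \<zeta> f) g)"
      unfolding I_def by (rule contour_integral_eq) (simp only: resolvent[OF f Smem])
    ultimately show ?thesis using uip[OF g] by (simp add: c_def)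
  qed
  show ?thesis
    unfolding disc_calculus_def using A r F calc by blast
qed

end

section \<open>Derivatives of functions in a scalar reproducing kernel space\<close>

lemma dbar_funpow: "(dbar ^^ j) g w = cnj ((deriv ^^ j) (\<lambda>v. cnj (g v)) w)"
  by (induction j arbitrary: w) (simp_all add: dbar_def)

locale scalar_rkhs = rkhs 1 "scalar_kernel K" H for K :: "complex \<Rightarrow> complex \<Rightarrow> complex" and H :: hspace
begin

definition kvec :: "complex \<Rightarrow> vfun" where
  "kvec w = kernel_section 1 (scalar_kernel K) w (\<lambda>_. 1)"

lemma kvec_mem: "w \<in> ball 0 1 \<Longrightarrow> kvec w \<in> carr H"
  unfolding kvec_def by (rule section_mem)

lemma ip_kvec: "\<lbrakk>f \<in> carr H; w \<in> ball 0 1\<rbrakk> \<Longrightarrow> ip H f (kvec w) = f w 0"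
  unfolding kvec_def using reproducing[of f w "\<lambda>_. 1"] by simp

lemma kvec_apply: "x \<in> ball 0 1 \<Longrightarrow> kvec w x 0 = K x w"
  by (simp add: kvec_def kernel_section_def scalar_kernel_def)

lemma ip_kvec_kvec: "\<lbrakk>w \<in> ball 0 1; z \<in> ball 0 1\<rbrakk> \<Longrightarrow> ip H (kvec w) (kvec z) = K z w"
  using ip_kvec[OF kvec_mem] kvec_apply by simp

lemma holomorphic_component: "f \<in> carr H \<Longrightarrow> (\<lambda>z. f z 0) holomorphic_on ball 0 1"
  using holomorphic by simp

text \<open>
  Each function is bounded on a small closed disc around \<open>w\<close>. So the evaluations on this disc
  are uniformly bounded, and the Cauchy estimates bound the derivatives at the centre.
\<close>
lemma derivative_functional_bounded:
  assumes w: "w \<in> ball 0 1"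
  obtains C where "0 \<le> C" "\<And>f. f \<in> carr H \<Longrightarrow> cmod ((deriv ^^ j) (\<lambda>z. f z 0) w) \<le> C * hnorm H f"
proof -
  obtain r where r: "0 < r" and sub: "cball w r \<subseteq> ball 0 1"
    using w open_contains_cball by blast
  obtain C where C: "0 \<le> C"
    "\<And>z f. z \<in> cball w r \<Longrightarrow> f \<in> carr H \<Longrightarrow> cmod (ip H f (kvec z)) \<le> C * hnorm H f"
  proof (rule uniform_boundedness[of "cball w r" kvec])
    show "kvec z \<in> carr H" if "z \<in> cball w r" for z using that sub kvec_mem by blast
    fix f assume f: "f \<in> carr H"
    have "compact ((\<lambda>z. f z 0) ` cball w r)"
      by (intro compact_continuous_image holomorphic_on_imp_continuous_on
          holomorphic_on_subset[OF holomorphic_component[OF f] sub]) auto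
    then obtain B where "\<forall>y\<in>(\<lambda>z. f z 0) ` cball w r. cmod y \<le> B"
      using compact_imp_bounded bounded_iff by blast
    then show "\<exists>B. \<forall>z\<in>cball w r. cmod (ip H f (kvec z)) \<le> B"
      using ip_kvec[OF f] sub by (metis imageI subset_iff)
  qed blast
  show ?thesis
  proof
    show "0 \<le> fact j * C / r ^ j" using C(1) r by simp
    fix f assume f: "f \<in> carr H"
    have "cmod ((deriv ^^ j) (\<lambda>z. f z 0) w) \<le> fact j * (C * hnorm H f) / r ^ j"
    proof (rule Cauchy_inequality)
      show "(\<lambda>z. f z 0) holomorphic_on ball w r"
        by (rule holomorphic_on_subset[OF holomorphic_component[OF f]]) (use sub ball_subset_cball in blast)
      show "continuous_on (cball w r) (\<lambda>z. f z 0)"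
        by (rule holomorphic_on_imp_continuous_on[OF holomorphic_on_subset[OF holomorphic_component[OF f] sub]])
      fix z assume "cmod (w - z) = r"
      then have z: "z \<in> cball w r" by (simp add: dist_norm)
      then show "cmod (f z 0) \<le> C * hnorm H f" using C(2)[OF z f] ip_kvec[OF f, of z] sub by auto
    qed (rule r)
    then show "cmod ((deriv ^^ j) (\<lambda>z. f z 0) w) \<le> fact j * C / r ^ j * hnorm H f" by simp
  qed
qed

lemma deriv_component_add:
  assumes "f \<in> carr H" "g \<in> carr H" "w \<in> ball 0 1"
  shows "(deriv ^^ j) (\<lambda>z. (f + g) z 0) w = (deriv ^^ j) (\<lambda>z. f z 0) w + (deriv ^^ j) (\<lambda>z. g z 0) w"
  using higher_deriv_add[OF holomorphic_component holomorphic_component open_ball] assms by simp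

lemma deriv_component_scale:
  assumes "f \<in> carr H" "w \<in> ball 0 1"
  shows "(deriv ^^ j) (\<lambda>z. cscale c f z 0) w = c * (deriv ^^ j) (\<lambda>z. f z 0) w"
  using higher_deriv_cmult[OF holomorphic_component] assms by (simp add: cscale_def)

text \<open>
  The vector that represents \<open>f \<mapsto> f\<^sup>(\<^sup>j\<^sup>)(w)\<close>. As a function it is the \<open>j\<close>-th antiholomorphic derivative of
  the kernel in its second variable, see \<open>dvec_apply\<close>; choosing it by its reproducing property makes
  membership in the space part of the choice.
\<close>
definition dvec :: "nat \<Rightarrow> complex \<Rightarrow> vfun" where
  "dvec j w = (SOME g. g \<in> carr H \<and> (\<forall>f\<in>carr H. ip H f g = (deriv ^^ j) (\<lambda>z. f z 0) w))"

lemma dvec_mem: "w \<in> ball 0 1 \<Longrightarrow> dvec j w \<in> carr H"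
  and ip_dvec: "w \<in> ball 0 1 \<Longrightarrow> f \<in> carr H \<Longrightarrow> ip H f (dvec j w) = (deriv ^^ j) (\<lambda>z. f z 0) w"
proof -
  have "dvec j w \<in> carr H \<and> (\<forall>f\<in>carr H. ip H f (dvec j w) = (deriv ^^ j) (\<lambda>z. f z 0) w)"
    if w: "w \<in> ball 0 1"
  proof -
    obtain C where C: "0 \<le> C" "\<And>f. f \<in> carr H \<Longrightarrow> cmod ((deriv ^^ j) (\<lambda>z. f z 0) w) \<le> C * hnorm H f"
      using derivative_functional_bounded[OF w] by blast
    let ?R = "(\<lambda>f. (f, (deriv ^^ j) (\<lambda>z. f z 0) w)) ` carr H"
    obtain l where "l \<in> carr H" "\<And>h s. (h, s) \<in> ?R \<Longrightarrow> ip H h l = s"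
    proof (rule riesz_relation[of ?R C])
      show "?R \<noteq> {}" using mem_0 by blast
      show "(h + h', s + s') \<in> ?R" if "(h, s) \<in> ?R" "(h', s') \<in> ?R" for h s h' s'
        using that deriv_component_add[OF _ _ w] mem_add by (auto simp: image_iff)
      show "(cscale c h, c * s) \<in> ?R" if "(h, s) \<in> ?R" for h s c
        using that deriv_component_scale[OF _ w] mem_scale by (auto simp: image_iff)
    qed (use C in auto)
    then have "\<exists>g. g \<in> carr H \<and> (\<forall>f\<in>carr H. ip H f g = (deriv ^^ j) (\<lambda>z. f z 0) w)" by blast
    then show ?thesis unfolding dvec_def by (rule someI_ex)
  qed
  then show "w \<in> ball 0 1 \<Longrightarrow> dvec j w \<in> carr H"
    "w \<in> ball 0 1 \<Longrightarrow> f \<in> carr H \<Longrightarrow> ip H f (dvec j w) = (deriv ^^ j) (\<lambda>z. f z 0) w" by blast+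
qed

lemma dvec_apply:
  assumes w: "w \<in> ball 0 1" and x: "x \<in> ball 0 1"
  shows "dvec j w x 0 = (dbar ^^ j) (K x) w"
proof -
  have herm: "kvec x u 0 = cnj (K x u)" if u: "u \<in> ball 0 1" for u
    using ip_commute[OF kvec_mem[OF x] kvec_mem[OF u]] ip_kvec_kvec[OF x u] ip_kvec_kvec[OF u x]
      kvec_apply[OF u] by simp
  have "dvec j w x 0 = cnj (ip H (kvec x) (dvec j w))"
    using ip_kvec[OF dvec_mem[OF w] x] ip_commute[OF dvec_mem[OF w] kvec_mem[OF x]] by simp
  also have "\<dots> = cnj ((deriv ^^ j) (\<lambda>u. kvec x u 0) w)"
    using ip_dvec[OF w kvec_mem[OF x]] by simp
  also have "(deriv ^^ j) (\<lambda>u. kvec x u 0) w = (deriv ^^ j) (\<lambda>u. cnj (K x u)) w"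
  proof (rule higher_deriv_cong_ev)
    show "\<forall>\<^sub>F u in nhds w. kvec x u 0 = cnj (K x u)"
      using eventually_nhds_in_open[OF open_ball w] by eventually_elim (rule herm)
  qed simp
  finally show ?thesis by (simp add: dbar_funpow)
qed

text \<open>
  The entries of the jet kernel, apart from the factor \<open>K\<^sub>1\<close>, are inner products in \<open>(\<H>, K\<^sub>2)\<close>.
\<close>
lemma ip_dvec_dvec:
  assumes w: "w \<in> ball 0 1" and z: "z \<in> ball 0 1"
  shows "ip H (dvec j w) (dvec i z) = (deriv ^^ i) (\<lambda>x. (dbar ^^ j) (K x) w) z"
  unfolding ip_dvec[OF z dvec_mem[OF w]]
proof (rule higher_deriv_cong_ev)
  show "\<forall>\<^sub>F x in nhds z. dvec j w x 0 = (dbar ^^ j) (K x) w"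
    using eventually_nhds_in_open[OF open_ball z] by eventually_elim (rule dvec_apply[OF w])
qed simp

end

section \<open>Operators on the space of jets\<close>

locale jet_space = H1: scalar_rkhs K1 H1 + H2: scalar_rkhs K2 H2 + H: rkhs N "jet_kernel K1 K2" H
  for K1 K2 :: "complex \<Rightarrow> complex \<Rightarrow> complex" and N :: nat and H1 H2 H :: hspace
begin

text \<open>
  The vector that represents the functional which pairs the jet of order \<open>N - 1\<close> at \<open>w\<close> with \<open>\<eta>\<close>.
\<close>
definition jvec :: "complex \<Rightarrow> (nat \<Rightarrow> complex) \<Rightarrow> vfun" where
  "jvec w \<eta> = (\<Sum>j<N. cscale (\<eta> j) (H2.dvec j w))"

abbreviation sec :: "complex \<Rightarrow> (nat \<Rightarrow> complex) \<Rightarrow> vfun" where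
  "sec \<equiv> kernel_section N (jet_kernel K1 K2)"

lemma jvec_mem: "w \<in> ball 0 1 \<Longrightarrow> jvec w \<eta> \<in> carr H2"
  unfolding jvec_def by (intro H2.mem_sum H2.mem_scale H2.dvec_mem)

lemma ip_jvec:
  assumes "w \<in> ball 0 1" "f \<in> carr H2"
  shows "ip H2 f (jvec w \<eta>) = (\<Sum>j<N. cnj (\<eta> j) * (deriv ^^ j) (\<lambda>z. f z 0) w)"
  unfolding jvec_def using assms
  by (subst H2.ip_sum_right) (simp_all add: H2.ip_scale_right H2.ip_dvec H2.dvec_mem H2.mem_scale)

lemma jvec_scale: "jvec w (\<lambda>i. c * \<eta> i) = cscale c (jvec w \<eta>)"
  unfolding jvec_def vfun.scale_sum_right by simp

text \<open>
  The section of the jet kernel at \<open>w\<close> in direction \<open>\<eta>\<close> behaves like the elementary tensor of the kernel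
  function of \<open>K\<^sub>1\<close> at \<open>w\<close> and \<open>jvec w \<eta>\<close>.
\<close>
lemma ip_sec_sec:
  assumes w: "w \<in> ball 0 1" and z: "z \<in> ball 0 1"
  shows "ip H (sec w \<eta>) (sec z \<xi>) = ip H1 (H1.kvec w) (H1.kvec z) * ip H2 (jvec w \<eta>) (jvec z \<xi>)"
proof -
  have "ip H2 (jvec w \<eta>) (jvec z \<xi>) = (\<Sum>j<N. cnj (\<xi> j) * ip H2 (jvec w \<eta>) (H2.dvec j z))"
    unfolding ip_jvec[OF z jvec_mem[OF w]] by (simp only: H2.ip_dvec[OF z jvec_mem[OF w]])
  also have "\<dots> = (\<Sum>j<N. cnj (\<xi> j) * (\<Sum>i<N. \<eta> i * (deriv ^^ j) (\<lambda>x. (dbar ^^ i) (K2 x) w) z))"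
  proof (intro sum.cong refl arg_cong2[where f = "(*)"])
    fix j
    show "ip H2 (jvec w \<eta>) (H2.dvec j z) = (\<Sum>i<N. \<eta> i * (deriv ^^ j) (\<lambda>x. (dbar ^^ i) (K2 x) w) z)"
      unfolding jvec_def using w z
      by (subst H2.ip_sum) (simp_all add: H2.dvec_mem H2.mem_scale H2.ip_scale H2.ip_dvec_dvec)
  qed
  finally have *: "ip H2 (jvec w \<eta>) (jvec z \<xi>) =
    (\<Sum>j<N. cnj (\<xi> j) * (\<Sum>i<N. \<eta> i * (deriv ^^ j) (\<lambda>x. (dbar ^^ i) (K2 x) w) z))" .
  show ?thesis
    unfolding * H.reproducing[OF H.section_mem[OF w] z] H1.ip_kvec_kvec[OF w z]
    using z by (auto simp: kernel_section_def jet_kernel_def sum_distrib_left sum_distrib_right mult_ac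
        intro!: sum.cong)
qed

lemma sec_scale: "sec w (\<lambda>i. c * \<eta> i) = cscale c (sec w \<eta>)"
  by (auto simp: kernel_section_def cscale_def fun_eq_iff sum_distrib_left mult_ac)

text \<open>
  The operator that \<open>L1 \<otimes> L2\<close> induces on jets when \<open>L1\<close> is the weighted composition with weight \<open>a\<close> and
  \<open>L2\<close> acts on derivatives through the matrix \<open>\<Psi>\<close>.
\<close>
definition jet_op :: "(complex \<Rightarrow> complex) \<Rightarrow> (nat \<Rightarrow> nat \<Rightarrow> complex \<Rightarrow> complex) \<Rightarrow> (complex \<Rightarrow> complex) \<Rightarrow> vfun \<Rightarrow> vfun" where
  "jet_op a \<Psi> \<phi> f = (\<lambda>z i. if z \<in> ball 0 1 \<and> i < N
     then a z * (\<Sum>l<N. \<Psi> i l z * f (\<phi> z) l) else 0)"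

text \<open>
  The adjoint of the induced operator should send kernel sections to kernel sections, with the
  direction changed by the adjoint matrix weight. Under the identification with elementary tensors
  this map is a restriction of the tensor product of the adjoints of \<open>L1\<close> and \<open>L2\<close>, hence bounded.
  The Riesz theorem on the span of the kernel sections then shows that the image of
  \<open>f\<close> lies in the space, and gives its norm bound.
\<close>
lemma jet_op_bounded:
  assumes L1: "bounded_op H1 L1" and L2: "bounded_op H2 L2"
    and \<phi>: "\<And>w. w \<in> ball 0 1 \<Longrightarrow> \<phi> w \<in> ball 0 1"
    and a: "\<And>h w. h \<in> carr H1 \<Longrightarrow> w \<in> ball 0 1 \<Longrightarrow> L1 h w 0 = a w * h (\<phi> w) 0"
    and \<Psi>: "\<And>h w j. h \<in> carr H2 \<Longrightarrow> w \<in> ball 0 1 \<Longrightarrow> j < N \<Longrightarrow>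
      (deriv ^^ j) (\<lambda>z. L2 h z 0) w = (\<Sum>l<N. \<Psi> j l w * (deriv ^^ l) (\<lambda>z. h z 0) (\<phi> w))"
  shows "bounded_op H (jet_op a \<Psi> \<phi>)"
proof -
  obtain C1' where "\<And>h. h \<in> carr H1 \<Longrightarrow> hnorm H1 (L1 h) \<le> C1' * hnorm H1 h"
    using L1 unfolding bounded_op_def by blast
  then have C1: "\<And>h. h \<in> carr H1 \<Longrightarrow> hnorm H1 (L1 h) \<le> \<bar>C1'\<bar> * hnorm H1 h"
    by (meson H1.hnorm_nonneg abs_ge_self mult_right_mono order_trans)
  obtain C2' where "\<And>h. h \<in> carr H2 \<Longrightarrow> hnorm H2 (L2 h) \<le> C2' * hnorm H2 h"
    using L2 unfolding bounded_op_def by blast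
  then have C2: "\<And>h. h \<in> carr H2 \<Longrightarrow> hnorm H2 (L2 h) \<le> \<bar>C2'\<bar> * hnorm H2 h"
    by (meson H2.hnorm_nonneg abs_ge_self mult_right_mono order_trans)
  define C where "C = \<bar>C1'\<bar> * \<bar>C2'\<bar>"
  have C0: "0 \<le> C" by (simp add: C_def)
  \<comment> \<open>The adjoint of the matrix weight \<open>\<Psi>\<close>. Below, \<open>S\<close> is a kernel section and \<open>T\<close> its image under the
    adjoint of the induced operator; elements of the span of kernel sections are sums over lists.\<close>
  define \<theta> where "\<theta> w \<eta> l = (\<Sum>i<N. cnj (\<Psi> i l w) * \<eta> i)" for w and \<eta> :: "nat \<Rightarrow> complex" and l
  define S where "S p = sec (fst p) (snd p)" for p
  define T where "T p = sec (\<phi> (fst p)) (\<lambda>l. cnj (a (fst p)) * \<theta> (fst p) (snd p) l)" for p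
  define valid where "valid xs \<longleftrightarrow> fst ` set xs \<subseteq> ball 0 1" for xs :: "(complex \<times> (nat \<Rightarrow> complex)) list"
  have memS: "S p \<in> carr H" and memT: "T p \<in> carr H" if "fst p \<in> ball 0 1" for p
    using that \<phi> by (simp_all add: S_def T_def H.section_mem del: mem_ball)
  have norm_le: "hnorm H (\<Sum>k<length xs. T (xs ! k)) \<le> C * hnorm H (\<Sum>k<length xs. S (xs ! k))"
    if xs: "valid xs" for xs
  proof -
    define I where "I = {..<length xs}"
    define w where "w k = fst (xs ! k)" for k
    define \<eta> where "\<eta> k = snd (xs ! k)" for k
    have w: "w k \<in> ball 0 1" if "k \<in> I" for k
      using xs that nth_mem[of k xs] unfolding valid_def w_def I_def by blast
    have mem: "S (xs ! k) \<in> carr H" "T (xs ! k) \<in> carr H" if "k \<in> I" for k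
      using memS memT w[OF that] by (auto simp: w_def)
    define x where "x k = H1.kvec (w k)" for k
    define x' where "x' k = cscale (cnj (a (w k))) (H1.kvec (\<phi> (w k)))" for k
    define y where "y k = jvec (w k) (\<eta> k)" for k
    define y' where "y' k = jvec (\<phi> (w k)) (\<theta> (w k) (\<eta> k))" for k
    have x: "x k \<in> carr H1" "x' k \<in> carr H1" if "k \<in> I" for k
      using w[OF that] \<phi> by (simp_all add: x_def x'_def H1.kvec_mem H1.mem_scale)
    have y: "y k \<in> carr H2" "y' k \<in> carr H2" if "k \<in> I" for k
      using w[OF that] \<phi> by (simp_all add: y_def y'_def jvec_mem)
    have S: "ip H (S (xs ! k)) (S (xs ! m)) = ip H1 (x k) (x m) * ip H2 (y k) (y m)"
      if "k \<in> I" "m \<in> I" for k m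
      using ip_sec_sec[OF w w] that by (simp add: S_def x_def y_def w_def \<eta>_def)
    have T: "ip H (T (xs ! k)) (T (xs ! m)) = ip H1 (x' k) (x' m) * ip H2 (y' k) (y' m)"
      if "k \<in> I" "m \<in> I" for k m
      using ip_sec_sec[OF \<phi>[OF w] \<phi>[OF w]] that jvec_mem[OF \<phi>[OF w]] H1.kvec_mem[OF \<phi>[OF w]]
      by (simp add: T_def x'_def y'_def jvec_scale H2.ip_scale H2.ip_scale_right H2.mem_scale
          H1.ip_scale H1.ip_scale_right H1.mem_scale flip: w_def \<eta>_def)
    have "Re (\<Sum>k\<in>I. \<Sum>m\<in>I. ip H1 (x' k) (x' m) * ip H2 (y' k) (y' m))
        \<le> C\<^sup>2 * Re (\<Sum>k\<in>I. \<Sum>m\<in>I. ip H1 (x k) (x m) * ip H2 (y k) (y m))"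
      unfolding C_def
    proof (rule tensor_contraction[OF H1.hilbert_space_axioms H2.hilbert_space_axioms])
      show "finite I" by (simp add: I_def)
      show "hnorm H1 (\<Sum>k\<in>I. cscale (c k) (x' k)) \<le> \<bar>C1'\<bar> * hnorm H1 (\<Sum>k\<in>I. cscale (c k) (x k))" for c
      proof (rule H1.adjoint_family_bound[OF L1 C1])
        fix k h assume k: "k \<in> I" and h: "h \<in> carr H1"
        then have Lh: "L1 h \<in> carr H1" using L1 by (auto simp: bounded_op_def)
        show "ip H1 (L1 h) (x k) = ip H1 h (x' k)"
          using a[OF h w[OF k]] h w[OF k] \<phi>[OF w[OF k]]
          by (simp add: x_def x'_def H1.ip_kvec Lh H1.ip_scale_right H1.kvec_mem)
      qed (use x in auto)
      show "hnorm H2 (\<Sum>k\<in>I. cscale (c k) (y' k)) \<le> \<bar>C2'\<bar> * hnorm H2 (\<Sum>k\<in>I. cscale (c k) (y k))" for c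
      proof (rule H2.adjoint_family_bound[OF L2 C2])
        fix k h assume k: "k \<in> I" and h: "h \<in> carr H2"
        then have Lh: "L2 h \<in> carr H2" using L2 by (auto simp: bounded_op_def)
        have "ip H2 (L2 h) (y k) = (\<Sum>j<N. cnj (\<eta> k j) *
            (\<Sum>l<N. \<Psi> j l (w k) * (deriv ^^ l) (\<lambda>z. h z 0) (\<phi> (w k))))"
          unfolding y_def ip_jvec[OF w[OF k] Lh] using \<Psi>[OF h w[OF k]] by (intro sum.cong) auto
        also have "\<dots> = (\<Sum>l<N. (\<Sum>j<N. \<Psi> j l (w k) * cnj (\<eta> k j)) *
            (deriv ^^ l) (\<lambda>z. h z 0) (\<phi> (w k)))"
          unfolding sum_distrib_left sum_distrib_right by (subst sum.swap) (simp only: mult_ac)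
        also have "\<dots> = ip H2 h (y' k)"
          unfolding y'_def ip_jvec[OF \<phi>[OF w[OF k]] h] by (simp add: \<theta>_def cnj_sum)
        finally show "ip H2 (L2 h) (y k) = ip H2 h (y' k)" .
      qed (use y in auto)
    qed (use x y in auto)
    moreover have "(hnorm H (\<Sum>k\<in>I. S (xs ! k)))\<^sup>2
        = Re (\<Sum>k\<in>I. \<Sum>m\<in>I. ip H1 (x k) (x m) * ip H2 (y k) (y m))"
      using mem S by (simp add: H.hnorm_sq H.mem_sum H.ip_sum_sum)
    moreover have "(hnorm H (\<Sum>k\<in>I. T (xs ! k)))\<^sup>2
        = Re (\<Sum>k\<in>I. \<Sum>m\<in>I. ip H1 (x' k) (x' m) * ip H2 (y' k) (y' m))"
      using mem T by (simp add: H.hnorm_sq H.mem_sum H.ip_sum_sum)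
    ultimately have "(hnorm H (\<Sum>k\<in>I. T (xs ! k)))\<^sup>2 \<le> (C * hnorm H (\<Sum>k\<in>I. S (xs ! k)))\<^sup>2"
      by (simp add: power_mult_distrib)
    then show ?thesis unfolding I_def
      by (rule power2_le_imp_le) (use C0 mem in \<open>auto simp: I_def intro!: mult_nonneg_nonneg H.hnorm_nonneg H.mem_sum\<close>)
  qed
  have main: "jet_op a \<Psi> \<phi> f \<in> carr H \<and> hnorm H (jet_op a \<Psi> \<phi> f) \<le> C * hnorm H f" if f: "f \<in> carr H" for f
  proof -
    have list_sum: "(\<Sum>p\<leftarrow>xs. F p) = (\<Sum>k<length xs. F (xs ! k))"
      for F :: "(complex \<times> (nat \<Rightarrow> complex)) \<Rightarrow> vfun" and xs
      by (simp add: sum_list_sum_nth atLeast0LessThan)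
    have mem_list: "(\<Sum>p\<leftarrow>xs. S p) \<in> carr H" "(\<Sum>p\<leftarrow>xs. T p) \<in> carr H" if "valid xs" for xs
    proof -
      have "fst (xs ! k) \<in> ball 0 1" if "k < length xs" for k
        using \<open>valid xs\<close> nth_mem[OF that] unfolding valid_def by blast
      then show "(\<Sum>p\<leftarrow>xs. S p) \<in> carr H" "(\<Sum>p\<leftarrow>xs. T p) \<in> carr H"
        unfolding list_sum by (intro H.mem_sum memS memT; blast)+
    qed
    define scl where "scl c = map (\<lambda>p :: complex \<times> (nat \<Rightarrow> complex). (fst p, \<lambda>i. c * snd p i))" for c
    have sclS: "(\<Sum>p\<leftarrow>scl c xs. S p) = cscale c (\<Sum>p\<leftarrow>xs. S p)" for c xs
      by (induction xs) (auto simp: scl_def S_def sec_scale cscale_apply fun_eq_iff distrib_left)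
    have \<theta>s: "(\<lambda>l. cnj (a w) * \<theta> w (\<lambda>i. c * \<eta> i) l) = (\<lambda>l. c * (cnj (a w) * \<theta> w \<eta> l))" for w c \<eta>
      by (simp add: \<theta>_def sum_distrib_left mult_ac fun_eq_iff)
    have Ts: "T (w, \<lambda>i. c * \<eta> i) = cscale c (T (w, \<eta>))" for w c \<eta>
      unfolding T_def fst_conv snd_conv \<theta>s sec_scale ..
    have sclT: "(\<Sum>p\<leftarrow>scl c xs. T p) = cscale c (\<Sum>p\<leftarrow>xs. T p)" for c xs
      by (induction xs) (auto simp: scl_def Ts cscale_apply fun_eq_iff distrib_left)
    let ?R = "(\<lambda>xs. (\<Sum>p\<leftarrow>xs. S p, ip H (\<Sum>p\<leftarrow>xs. T p) f)) ` {xs. valid xs}"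
    have RE: thesis if "(h, s) \<in> ?R"
      and "\<And>xs. \<lbrakk>valid xs; h = (\<Sum>p\<leftarrow>xs. S p); s = ip H (\<Sum>p\<leftarrow>xs. T p) f\<rbrakk> \<Longrightarrow> thesis" for h s thesis
      using that by blast
    obtain l where l: "l \<in> carr H" and nl: "hnorm H l \<le> C * hnorm H f"
      and rep: "\<And>h s. (h, s) \<in> ?R \<Longrightarrow> ip H h l = s"
    proof (rule H.riesz_relation[of ?R "C * hnorm H f"])
      show "h \<in> carr H" if "(h, s) \<in> ?R" for h s using that mem_list(1) by blast
      show "cmod s \<le> C * hnorm H f * hnorm H h" if R: "(h, s) \<in> ?R" for h s
      proof -
        obtain xs where xs: "valid xs" and h: "h = (\<Sum>p\<leftarrow>xs. S p)" and s: "s = ip H (\<Sum>p\<leftarrow>xs. T p) f"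
          by (rule RE[OF R])
        have "cmod s \<le> hnorm H (\<Sum>p\<leftarrow>xs. T p) * hnorm H f"
          unfolding s by (rule H.cauchy_schwarz[OF mem_list(2)[OF xs] f])
        also have "\<dots> \<le> C * hnorm H h * hnorm H f"
          using norm_le[OF xs] unfolding h list_sum by (rule mult_right_mono[OF _ H.hnorm_nonneg[OF f]])
        finally show ?thesis by (simp only: mult_ac)
      qed
      have "valid []" by (simp add: valid_def)
      then show "?R \<noteq> {}" by blast
      show "(h + h', s + s') \<in> ?R" if R: "(h, s) \<in> ?R" "(h', s') \<in> ?R" for h s h' s'
      proof -
        obtain xs ys where "valid xs" and h: "h = (\<Sum>p\<leftarrow>xs. S p)" "s = ip H (\<Sum>p\<leftarrow>xs. T p) f"
          and "valid ys" and h': "h' = (\<Sum>p\<leftarrow>ys. S p)" "s' = ip H (\<Sum>p\<leftarrow>ys. T p) f"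
          by (rule RE[OF R(1)], rule RE[OF R(2)])
        have "(h + h', s + s') = (\<Sum>p\<leftarrow>xs @ ys. S p, ip H (\<Sum>p\<leftarrow>xs @ ys. T p) f)"
          unfolding h h' map_append sum_list_append
            H.ip_add[OF mem_list(2)[OF \<open>valid xs\<close>] mem_list(2)[OF \<open>valid ys\<close>] f] ..
        moreover have "valid (xs @ ys)" using \<open>valid xs\<close> \<open>valid ys\<close> by (auto simp: valid_def)
        ultimately show ?thesis by blast
      qed
      show "(cscale c h, c * s) \<in> ?R" if R: "(h, s) \<in> ?R" for h s c
      proof -
        obtain xs where xs: "valid xs" and h: "h = (\<Sum>p\<leftarrow>xs. S p)" and s: "s = ip H (\<Sum>p\<leftarrow>xs. T p) f"
          by (rule RE[OF R])
        have "valid (scl c xs)" using xs by (auto simp: valid_def scl_def)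
        moreover have "(cscale c h, c * s) = (\<Sum>p\<leftarrow>scl c xs. S p, ip H (\<Sum>p\<leftarrow>scl c xs. T p) f)"
          unfolding h s sclS sclT H.ip_scale[OF mem_list(2)[OF xs] f] ..
        ultimately show ?thesis by blast
      qed
      show "0 \<le> C * hnorm H f" using C0 H.hnorm_nonneg[OF f] by simp
    qed blast
    have "l z i = jet_op a \<Psi> \<phi> f z i" for z i
    proof (cases "z \<in> ball 0 1 \<and> i < N")
      case True
      then have z: "z \<in> ball 0 1" and i: "i < N" by auto
      \<comment> \<open>Testing with a coordinate direction reads off the components of the representing vector.\<close>
      define \<delta> :: "nat \<Rightarrow> complex" where "\<delta> j = (if j = i then 1 else 0)" for j
      have "(S (z, \<delta>), ip H (T (z, \<delta>)) f) \<in> ?R"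
        using z by (intro image_eqI[of _ _ "[(z, \<delta>)]"]) (auto simp: valid_def)
      then have "ip H (S (z, \<delta>)) l = ip H (T (z, \<delta>)) f" by (rule rep)
      then have "ip H l (S (z, \<delta>)) = ip H f (T (z, \<delta>))"
        using H.ip_commute[OF l memS[of "(z, \<delta>)"]] H.ip_commute[OF f memT[of "(z, \<delta>)"]] z by simp
      then have "(\<Sum>j<N. l z j * cnj (\<delta> j)) = (\<Sum>j<N. f (\<phi> z) j * cnj (cnj (a z) * \<theta> z \<delta> j))"
        unfolding S_def T_def fst_conv snd_conv H.reproducing[OF l z] H.reproducing[OF f \<phi>[OF z]] .
      moreover have "(\<Sum>j<N. l z j * cnj (\<delta> j)) = l z i"
      proof -
        have "(\<Sum>j<N. l z j * cnj (\<delta> j)) = (\<Sum>j<N. if j = i then l z j else 0)"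
          by (intro sum.cong) (auto simp: \<delta>_def)
        then show ?thesis using i by simp
      qed
      moreover have "\<theta> z \<delta> j = cnj (\<Psi> i j z)" for j
      proof -
        have "\<theta> z \<delta> j = (\<Sum>k<N. if k = i then cnj (\<Psi> k j z) else 0)"
          unfolding \<theta>_def by (intro sum.cong) (auto simp: \<delta>_def)
        then show ?thesis using i by simp
      qed
      ultimately show ?thesis
        using z i by (simp add: jet_op_def sum_distrib_left mult_ac)
    next
      case False
      then show ?thesis using H.extensional[OF l, of z i] by (auto simp: jet_op_def)
    qed
    then have "l = jet_op a \<Psi> \<phi> f" by (intro ext)
    then show ?thesis using l nl by simp
  qed
  moreover have "jet_op a \<Psi> \<phi> (f + g) = jet_op a \<Psi> \<phi> f + jet_op a \<Psi> \<phi> g" for f g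
    by (auto simp: jet_op_def fun_eq_iff distrib_left sum.distrib)
  moreover have "jet_op a \<Psi> \<phi> (cscale c f) = cscale c (jet_op a \<Psi> \<phi> f)" for c f
    by (auto simp: jet_op_def cscale_def fun_eq_iff sum_distrib_left mult_ac)
  ultimately show ?thesis unfolding bounded_op_def by blast
qed

end

section \<open>Derivatives of weighted compositions\<close>

text \<open>
  The coefficients in the formula for the derivatives of a weighted composition \<open>g \<cdot> (f \<circ> \<phi>)\<close> through
  those of \<open>f\<close>. The recursion is the product and chain rule applied to one summand.
\<close>
primrec jet_coeff :: "(complex \<Rightarrow> complex) \<Rightarrow> (complex \<Rightarrow> complex) \<Rightarrow> nat \<Rightarrow> nat \<Rightarrow> complex \<Rightarrow> complex" where
  "jet_coeff g \<phi> 0 l = (\<lambda>w. if l = 0 then g w else 0)"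
| "jet_coeff g \<phi> (Suc j) l =
    (\<lambda>w. deriv (jet_coeff g \<phi> j l) w + (if l = 0 then 0 else jet_coeff g \<phi> j (l - 1) w * deriv \<phi> w))"

lemma jet_coeff_eq_0: "j < l \<Longrightarrow> jet_coeff g \<phi> j l = (\<lambda>_. 0)"
  by (induction j arbitrary: l) simp_all

lemma jet_coeff_holomorphic:
  assumes "g holomorphic_on S" "\<phi> holomorphic_on S" "open S"
  shows "jet_coeff g \<phi> j l holomorphic_on S"
proof (induction j arbitrary: l)
  case 0
  then show ?case using assms by (cases "l = 0") simp_all
next
  case (Suc j)
  then show ?case using assms by (cases "l = 0") (auto intro!: holomorphic_intros)
qed

lemma higher_deriv_weighted_composition:
  assumes g: "g holomorphic_on S" and \<phi>: "\<phi> holomorphic_on S" and f: "f holomorphic_on T"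
    and S: "open S" and T: "open T" and maps: "\<And>z. z \<in> S \<Longrightarrow> \<phi> z \<in> T" and w: "w \<in> S"
  shows "(deriv ^^ j) (\<lambda>z. g z * f (\<phi> z)) w = (\<Sum>l\<le>j. jet_coeff g \<phi> j l w * (deriv ^^ l) f (\<phi> w))"
  using w
proof (induction j arbitrary: w)
  case (Suc j)
  let ?c = "jet_coeff g \<phi> j"
  have holc: "?c l holomorphic_on S" for l by (rule jet_coeff_holomorphic[OF g \<phi> S])
  have holf: "(deriv ^^ l) f holomorphic_on T" for l by (rule holomorphic_higher_deriv[OF f T])
  have "\<forall>\<^sub>F z in nhds w. (deriv ^^ j) (\<lambda>z. g z * f (\<phi> z)) z = (\<Sum>l\<le>j. ?c l z * (deriv ^^ l) f (\<phi> z))"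
    using eventually_nhds_in_open[OF S Suc.prems] by eventually_elim (rule Suc.IH)
  then have "(deriv ^^ Suc j) (\<lambda>z. g z * f (\<phi> z)) w = deriv (\<lambda>z. \<Sum>l\<le>j. ?c l z * (deriv ^^ l) f (\<phi> z)) w"
    by (simp add: deriv_cong_ev)
  also have "\<dots> = (\<Sum>l\<le>j. deriv (?c l) w * (deriv ^^ l) f (\<phi> w)
      + ?c l w * deriv \<phi> w * (deriv ^^ Suc l) f (\<phi> w))"
  proof (rule DERIV_imp_deriv, rule DERIV_sum)
    fix l
    have c: "(?c l has_field_derivative deriv (?c l) w) (at w)"
      by (rule holomorphic_derivI[OF holc S Suc.prems])
    have "((\<lambda>z. (deriv ^^ l) f (\<phi> z)) has_field_derivative deriv ((deriv ^^ l) f) (\<phi> w) * deriv \<phi> w) (at w)"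
      by (rule DERIV_chain2[OF holomorphic_derivI[OF holf T maps[OF Suc.prems]]
            holomorphic_derivI[OF \<phi> S Suc.prems]])
    from DERIV_mult[OF c this]
    show "((\<lambda>z. ?c l z * (deriv ^^ l) f (\<phi> z)) has_field_derivative
        deriv (?c l) w * (deriv ^^ l) f (\<phi> w) + ?c l w * deriv \<phi> w * (deriv ^^ Suc l) f (\<phi> w)) (at w)"
      by (simp add: algebra_simps)
  qed
  also have "\<dots> = (\<Sum>l\<le>Suc j. deriv (?c l) w * (deriv ^^ l) f (\<phi> w))
      + (\<Sum>l\<le>Suc j. (if l = 0 then 0 else ?c (l - 1) w * deriv \<phi> w) * (deriv ^^ l) f (\<phi> w))"
  proof -
    have "(\<Sum>l\<le>Suc j. deriv (?c l) w * (deriv ^^ l) f (\<phi> w)) = (\<Sum>l\<le>j. deriv (?c l) w * (deriv ^^ l) f (\<phi> w))"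
      using jet_coeff_eq_0[of j "Suc j" g \<phi>] by simp
    moreover have "(\<Sum>l\<le>Suc j. (if l = 0 then 0 else ?c (l - 1) w * deriv \<phi> w) * (deriv ^^ l) f (\<phi> w))
        = (\<Sum>l\<le>j. ?c l w * deriv \<phi> w * (deriv ^^ Suc l) f (\<phi> w))"
      by (subst sum.atMost_Suc_shift) simp
    ultimately show ?thesis by (simp only: sum.distrib)
  qed
  also have "\<dots> = (\<Sum>l\<le>Suc j. jet_coeff g \<phi> (Suc j) l w * (deriv ^^ l) f (\<phi> w))"
    unfolding sum.distrib[symmetric] by (intro sum.cong refl) (simp add: distrib_right)
  finally show ?case .
qed simp

text \<open>
  Padding the triangular coefficients with zeros gives one square matrix for all orders below \<open>N\<close>.
\<close>
lemma higher_deriv_weighted_composition_lessThan: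
  assumes "g holomorphic_on S" "\<phi> holomorphic_on S" "f holomorphic_on T" "open S" "open T"
    "\<And>z. z \<in> S \<Longrightarrow> \<phi> z \<in> T" "w \<in> S" "j < N"
  shows "(deriv ^^ j) (\<lambda>z. g z * f (\<phi> z)) w = (\<Sum>l<N. jet_coeff g \<phi> j l w * (deriv ^^ l) f (\<phi> w))"
proof -
  have "(deriv ^^ j) (\<lambda>z. g z * f (\<phi> z)) w = (\<Sum>l\<le>j. jet_coeff g \<phi> j l w * (deriv ^^ l) f (\<phi> w))"
    by (rule higher_deriv_weighted_composition[OF assms(1-7)])
  also have "\<dots> = (\<Sum>l<N. jet_coeff g \<phi> j l w * (deriv ^^ l) f (\<phi> w))"
    using assms(8) by (intro sum.mono_neutral_left) (auto simp: jet_coeff_eq_0)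
  finally show ?thesis .
qed

text \<open>
  The composition of a weighted composition with its inverse is the identity, so the product of the
  two coefficient matrices fixes every jet. The jets of the powers of \<open>z - w\<close> at \<open>w\<close> are multiples of the
  unit vectors.
\<close>
lemma jet_coeff_inverse:
  assumes g: "g holomorphic_on S" and \<phi>: "\<phi> holomorphic_on S"
    and g': "g' holomorphic_on T" and \<phi>': "\<phi>' holomorphic_on T"
    and S: "open S" and T: "open T" and maps: "\<And>z. z \<in> S \<Longrightarrow> \<phi> z \<in> T" and maps': "\<And>z. z \<in> T \<Longrightarrow> \<phi>' z \<in> S"
    and inv: "\<And>z. z \<in> S \<Longrightarrow> \<phi>' (\<phi> z) = z" and ginv: "\<And>z. z \<in> S \<Longrightarrow> g z * g' (\<phi> z) = 1"
    and w: "w \<in> S" and i: "i < N" and m: "m < N"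
  shows "(\<Sum>l<N. jet_coeff g \<phi> i l w * jet_coeff g' \<phi>' l m (\<phi> w)) = (if i = m then 1 else 0)"
proof -
  define p where "p z = (z - w) ^ m" for z
  have p: "p holomorphic_on S" unfolding p_def by (intro holomorphic_intros)
  have dp: "(deriv ^^ l) p w = (if l = m then fact m else 0)" for l
    unfolding p_def higher_deriv_power
    by (cases l m rule: linorder_cases) (simp_all add: pochhammer_fact pochhammer_0_left)
  have "(deriv ^^ i) (\<lambda>z. g z * (g' (\<phi> z) * p (\<phi>' (\<phi> z)))) w
      = (\<Sum>l<N. jet_coeff g \<phi> i l w * (deriv ^^ l) (\<lambda>z. g' z * p (\<phi>' z)) (\<phi> w))"
    by (rule higher_deriv_weighted_composition_lessThan[OF g \<phi> _ S T maps w i])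
      (auto intro!: holomorphic_intros g' holomorphic_on_compose_gen[OF \<phi>' p, unfolded o_def] maps')
  also have "\<dots> = (\<Sum>l<N. jet_coeff g \<phi> i l w *
      (\<Sum>k<N. jet_coeff g' \<phi>' l k (\<phi> w) * (deriv ^^ k) p (\<phi>' (\<phi> w))))"
    by (intro sum.cong refl arg_cong2[where f = "(*)"]
        higher_deriv_weighted_composition_lessThan[OF g' \<phi>' p T S maps' maps[OF w]]) simp_all
  also have "\<dots> = (\<Sum>l<N. jet_coeff g \<phi> i l w * (jet_coeff g' \<phi>' l m (\<phi> w) * fact m))"
  proof (intro sum.cong refl arg_cong2[where f = "(*)"])
    fix l
    have "(\<Sum>k<N. jet_coeff g' \<phi>' l k (\<phi> w) * (deriv ^^ k) p (\<phi>' (\<phi> w)))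
        = (\<Sum>k<N. if k = m then jet_coeff g' \<phi>' l k (\<phi> w) * fact m else 0)"
      by (intro sum.cong) (auto simp: inv[OF w] dp)
    then show "(\<Sum>k<N. jet_coeff g' \<phi>' l k (\<phi> w) * (deriv ^^ k) p (\<phi>' (\<phi> w)))
        = jet_coeff g' \<phi>' l m (\<phi> w) * fact m" using m by simp
  qed
  also have "(deriv ^^ i) (\<lambda>z. g z * (g' (\<phi> z) * p (\<phi>' (\<phi> z)))) w = (deriv ^^ i) p w"
  proof (rule higher_deriv_cong_ev)
    show "\<forall>\<^sub>F z in nhds w. g z * (g' (\<phi> z) * p (\<phi>' (\<phi> z))) = p z"
      using eventually_nhds_in_open[OF S w]
      by eventually_elim (simp add: inv ginv flip: mult.assoc)
  qed simp
  finally show ?thesis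
    unfolding dp mult.assoc[symmetric] sum_distrib_right[symmetric] by (auto split: if_splits)
qed

section \<open>Weighted compositions from similarity and sharpness\<close>

context scalar_rkhs
begin

lemma kernel_diagonal_nonzero:
  assumes "positive_definite 1 (scalar_kernel K)" "w \<in> ball 0 1"
  shows "K w w \<noteq> 0"
proof -
  have "\<exists>B :: mkernel. \<forall>u\<in>{w}. \<forall>v\<in>{w}. \<forall>i<1. \<forall>j<1.
           (\<Sum>x\<in>{w}. \<Sum>l<1. scalar_kernel K u x i l * B x v l j) = (if u = v \<and> i = j then 1 else 0) \<and>
           (\<Sum>x\<in>{w}. \<Sum>l<1. B u x i l * scalar_kernel K x v l j) = (if u = v \<and> i = j then 1 else 0)"
    using assms unfolding positive_definite_def by blast
  then show ?thesis by (auto simp: scalar_kernel_def)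
qed

text \<open>
  The eigenvalue equation gives the value of \<^const>\<open>adj\<close> at \<open>x\<close> at once, because the vector with the
  adjoint property is unique.
\<close>
lemma eigenvector_of_adjoint:
  assumes sharp: "sharp K H" and w: "w \<in> ball 0 1" and x: "x \<in> carr H"
    and eig: "\<And>h. h \<in> carr H \<Longrightarrow> ip H (mult_z h) x = w * ip H h x"
  obtains c where "x = cscale c (kvec w)"
proof -
  have "adj H mult_z x = cscale (cnj w) x"
    unfolding adj_def
  proof (rule the_equality)
    show *: "cscale (cnj w) x \<in> carr H \<and> (\<forall>h\<in>carr H. ip H (mult_z h) x = ip H h (cscale (cnj w) x))"
      using x eig by (simp add: mem_scale ip_scale_right)
    fix g assume "g \<in> carr H \<and> (\<forall>h\<in>carr H. ip H (mult_z h) x = ip H h g)"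
    with * show "g = cscale (cnj w) x" by (intro eq_of_ip_eq) auto
  qed
  then have "x \<in> {f \<in> carr H. adj H mult_z f = cscale (cnj w) f}" using x by simp
  also have "\<dots> = vfun.span {kvec w}" using sharp w unfolding sharp_def kvec_def by blast
  finally show ?thesis using that unfolding vfun.span_singleton by blast
qed

text \<open>
  The functional \<open>h \<mapsto> (L h)(w)\<close> is represented by an eigenvector of the adjoint of \<open>M\<^sub>z\<close>, hence by a
  multiple of the kernel function at \<open>\<phi>(w)\<close>. The weight is holomorphic because near \<open>w\<close> it is a quotient
  \<open>L h / (h \<circ> \<phi>)\<close> for the kernel function \<open>h\<close> at \<open>\<phi>(w)\<close>, and it has no zeros because \<open>L\<close> is onto and kernel
  functions do not vanish on the diagonal.
\<close>
lemma intertwiner_is_weighted_composition: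
  assumes sharp: "sharp K H" and pd: "positive_definite 1 (scalar_kernel K)"
    and L: "bounded_op H L" and surj: "L ` carr H = carr H"
    and \<phi>: "\<phi> holomorphic_on ball 0 1" "\<And>w. w \<in> ball 0 1 \<Longrightarrow> \<phi> w \<in> ball 0 1"
    and inter: "\<And>h w. h \<in> carr H \<Longrightarrow> w \<in> ball 0 1 \<Longrightarrow> L (mult_z h) w 0 = \<phi> w * L h w 0"
  obtains g where "g holomorphic_on ball 0 1" "\<And>w. w \<in> ball 0 1 \<Longrightarrow> g w \<noteq> 0"
    "\<And>h w. h \<in> carr H \<Longrightarrow> w \<in> ball 0 1 \<Longrightarrow> L h w 0 = g w * h (\<phi> w) 0"
proof -
  have memL: "L h \<in> carr H" if "h \<in> carr H" for h using L that by (simp add: bounded_op_def)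
  have memM: "mult_z h \<in> carr H" if "h \<in> carr H" for h
    using sharp that by (simp add: sharp_def bounded_op_def)
  have "\<exists>c. \<forall>h\<in>carr H. L h w 0 = c * h (\<phi> w) 0" if w: "w \<in> ball 0 1" for w
  proof -
    obtain C where C: "\<And>h. h \<in> carr H \<Longrightarrow> hnorm H (L h) \<le> C * hnorm H h"
      using L unfolding bounded_op_def by blast
    let ?R = "(\<lambda>h. (h, L h w 0)) ` carr H"
    obtain x where x: "x \<in> carr H" and rep: "\<And>h s. (h, s) \<in> ?R \<Longrightarrow> ip H h x = s"
    proof (rule riesz_relation[of ?R "\<bar>C\<bar> * hnorm H (kvec w)"])
      show "cmod s \<le> \<bar>C\<bar> * hnorm H (kvec w) * hnorm H h" if R: "(h, s) \<in> ?R" for h s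
      proof -
        have h: "h \<in> carr H" and s: "s = L h w 0" using R by auto
        have "cmod s \<le> hnorm H (L h) * hnorm H (kvec w)"
          using cauchy_schwarz[OF memL[OF h] kvec_mem[OF w]] ip_kvec[OF memL[OF h] w] s by simp
        also have "\<dots> \<le> (\<bar>C\<bar> * hnorm H h) * hnorm H (kvec w)"
        proof (rule mult_right_mono)
          show "hnorm H (L h) \<le> \<bar>C\<bar> * hnorm H h"
            using C[OF h] mult_right_mono[OF abs_ge_self[of C] hnorm_nonneg[OF h]] by linarith
        qed (rule hnorm_nonneg[OF kvec_mem[OF w]])
        finally show ?thesis by (simp only: mult_ac)
      qed
      show "?R \<noteq> {}" using mem_0 by blast
      show "(h + h', s + s') \<in> ?R" if "(h, s) \<in> ?R" "(h', s') \<in> ?R" for h s h' s'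
        using that L mem_add by (auto simp: image_iff bounded_op_def)
      show "(cscale c h, c * s) \<in> ?R" if "(h, s) \<in> ?R" for h s c
        using that L mem_scale by (auto simp: image_iff bounded_op_def cscale_apply)
      show "0 \<le> \<bar>C\<bar> * hnorm H (kvec w)" using hnorm_nonneg[OF kvec_mem[OF w]] by simp
    qed auto
    have ipx: "ip H h x = L h w 0" if "h \<in> carr H" for h using rep that by blast
    obtain c where c: "x = cscale c (kvec (\<phi> w))"
    proof (rule eigenvector_of_adjoint[OF sharp \<phi>(2)[OF w] x])
      show "ip H (mult_z h) x = \<phi> w * ip H h x" if "h \<in> carr H" for h
        unfolding ipx[OF that] ipx[OF memM[OF that]] by (rule inter[OF that w])
    qed blast
    have "L h w 0 = cnj c * h (\<phi> w) 0" if h: "h \<in> carr H" for h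
      using ipx[OF h] ip_kvec[OF h \<phi>(2)[OF w]] ip_scale_right[OF h kvec_mem[OF \<phi>(2)[OF w]]]
      unfolding c by simp
    then show ?thesis by blast
  qed
  then obtain g where g: "\<And>h w. h \<in> carr H \<Longrightarrow> w \<in> ball 0 1 \<Longrightarrow> L h w 0 = g w * h (\<phi> w) 0"
    by metis
  show ?thesis
  proof
    show "L h w 0 = g w * h (\<phi> w) 0" if "h \<in> carr H" "w \<in> ball 0 1" for h w using g that .
    show "g w \<noteq> 0" if w: "w \<in> ball 0 1" for w
    proof
      assume g0: "g w = 0"
      obtain h where h: "h \<in> carr H" "L h = kvec w" using surj kvec_mem[OF w] by (metis imageE)
      have "K w w = L h w 0" unfolding h(2) using kvec_apply[OF w] by simp
      also have "\<dots> = 0" using g[OF h(1) w] g0 by simp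
      finally show False using kernel_diagonal_nonzero[OF pd w] by simp
    qed
    show "g holomorphic_on ball 0 1"
      unfolding holomorphic_on_open[OF open_ball]
    proof
      fix w :: complex assume w: "w \<in> ball 0 1"
      let ?h = "kvec (\<phi> w)"
      have h: "?h \<in> carr H" using \<phi>(2)[OF w] by (rule kvec_mem)
      have "\<phi> ` ball 0 1 \<subseteq> ball 0 1" using \<phi>(2) by blast
      from holomorphic_on_compose_gen[OF \<phi>(1) holomorphic_component[OF h] this]
      have hol: "(\<lambda>v. ?h (\<phi> v) 0) holomorphic_on ball 0 1" unfolding o_def .
      have ne: "?h (\<phi> w) 0 \<noteq> 0"
        using kernel_diagonal_nonzero[OF pd \<phi>(2)[OF w]] kvec_apply[OF \<phi>(2)[OF w]] by simp
      define U where "U = ball 0 1 \<inter> (\<lambda>v. ?h (\<phi> v) 0) -` (- {0})"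
      have U: "open U"
        unfolding U_def using holomorphic_on_imp_continuous_on[OF hol]
        by (rule continuous_open_preimage) auto
      have wU: "w \<in> U" using w ne by (simp add: U_def)
      have "(\<lambda>v. L ?h v 0 / ?h (\<phi> v) 0) holomorphic_on U"
        by (intro holomorphic_on_divide holomorphic_on_subset[OF hol]
            holomorphic_on_subset[OF holomorphic_component[OF memL[OF h]]]) (auto simp: U_def)
      moreover have "L ?h v 0 / ?h (\<phi> v) 0 = g v" if "v \<in> U" for v
        using that g[OF h, of v] by (simp add: U_def)
      ultimately have "g holomorphic_on U" by (simp cong: holomorphic_cong)
      then show "\<exists>f'. (g has_field_derivative f') (at w)"
        using U wU by (auto simp: holomorphic_on_open)
    qed
  qed
qed

text \<open>
  Similarity is an intertwining relation: \<open>\<phi>(M\<^sub>z) L = L M\<^sub>z\<close>, where \<open>\<phi>(M\<^sub>z)\<close> is multiplication by \<open>\<phi>\<close>.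
\<close>
lemma weakly_homogeneous_weighted_composition:
  assumes sharp: "sharp K H" and pd: "positive_definite 1 (scalar_kernel K)"
    and wh: "weakly_homogeneous H mult_z" and \<phi>: "\<phi> \<in> moeb"
  defines "\<phi>' \<equiv> inv_into (ball 0 1) \<phi>"
  obtains L L' g where "bounded_op H L" "bounded_op H L'" "g holomorphic_on ball 0 1"
    "\<And>w. w \<in> ball 0 1 \<Longrightarrow> g w \<noteq> 0"
    "\<And>h w. h \<in> carr H \<Longrightarrow> w \<in> ball 0 1 \<Longrightarrow> L h w 0 = g w * h (\<phi> w) 0"
    "\<And>h w. h \<in> carr H \<Longrightarrow> w \<in> ball 0 1 \<Longrightarrow> L' h w 0 = 1 / g (\<phi>' w) * h (\<phi>' w) 0"
proof -
  have bij: "bij_betw \<phi> (ball 0 1) (ball 0 1)" and hol: "\<phi> holomorphic_on ball 0 1"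
    using \<phi> by (auto simp: moeb_def)
  have maps: "\<phi> w \<in> ball 0 1" if "w \<in> ball 0 1" for w using bij that by (rule bij_betw_apply)
  have maps': "\<phi>' w \<in> ball 0 1" if "w \<in> ball 0 1" for w
    unfolding \<phi>'_def using bij_betw_inv_into[OF bij] that by (rule bij_betw_apply)
  obtain A where A: "disc_calculus H mult_z \<phi> A" "similar_op H A mult_z"
    and spec: "op_spectrum H mult_z \<subseteq> cball 0 1" and M: "bounded_op H mult_z"
    using wh \<phi> unfolding weakly_homogeneous_def by blast
  obtain L where L: "invertible_op H L" and AL: "\<And>f. f \<in> carr H \<Longrightarrow> A f = L (mult_z (inv_into (carr H) L f))"
    using A(2) unfolding similar_op_def by blast
  have bL: "bounded_op H L" and bijL: "bij_betw L (carr H) (carr H)" and bL': "bounded_op H (inv_into (carr H) L)"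
    using L by (auto simp: invertible_op_def)
  have inter: "L (mult_z h) w 0 = \<phi> w * L h w 0" if h: "h \<in> carr H" and w: "w \<in> ball 0 1" for h w
  proof -
    have Lh: "L h \<in> carr H" using bijL h by (rule bij_betw_apply)
    have "L (mult_z h) = A (L h)"
      using AL[OF Lh] bij_betw_inv_into_left[OF bijL h] by simp
    then show ?thesis using disc_calculus_apply[OF spec A(1) Lh w, of 0] by simp
  qed
  obtain g where g: "g holomorphic_on ball 0 1" "\<And>w. w \<in> ball 0 1 \<Longrightarrow> g w \<noteq> 0"
    "\<And>h w. h \<in> carr H \<Longrightarrow> w \<in> ball 0 1 \<Longrightarrow> L h w 0 = g w * h (\<phi> w) 0"
    using intertwiner_is_weighted_composition[OF sharp pd bL bij_betw_imp_surj_on[OF bijL] hol maps inter]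
    by blast
  have "inv_into (carr H) L h w 0 = 1 / g (\<phi>' w) * h (\<phi>' w) 0" if h: "h \<in> carr H" and w: "w \<in> ball 0 1" for h w
  proof -
    have "inv_into (carr H) L h \<in> carr H" "L (inv_into (carr H) L h) = h"
      using bL' h bij_betw_inv_into_right[OF bijL h] by (auto simp: bounded_op_def)
    then have "h (\<phi>' w) 0 = g (\<phi>' w) * inv_into (carr H) L h (\<phi> (\<phi>' w)) 0"
      using g(3)[OF _ maps'[OF w]] by metis
    also have "\<phi> (\<phi>' w) = w" unfolding \<phi>'_def using bij_betw_inv_into_right[OF bij w] .
    finally show ?thesis using g(2)[OF maps'[OF w]] by simp
  qed
  then show ?thesis using that[OF bL bL' g(1,2,3)] by blast
qed

end

section \<open>Weak homogeneity on the space of jets\<close>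

context jet_space
begin

text \<open>
  A multiplier of the first factor induces multiplication by the same function on jets, because the
  derivatives are taken in the second variable only.
\<close>
lemma mult_fun_bounded:
  assumes L1: "bounded_op H1 L1" and a: "\<And>h w. h \<in> carr H1 \<Longrightarrow> w \<in> ball 0 1 \<Longrightarrow> L1 h w 0 = a w * h w 0"
  shows "bounded_op H (mult_fun a)"
proof (rule H.bounded_op_cong)
  let ?\<Psi> = "\<lambda>j l (_::complex). if l = j then 1 else 0 :: complex"
  have delta: "(\<Sum>l<N. (if l = j then 1 else 0) * F l) = F j" if "j < N" for j and F :: "nat \<Rightarrow> complex"
  proof -
    have "(\<Sum>l<N. (if l = j then 1 else 0) * F l) = (\<Sum>l<N. if l = j then F l else 0)"
      by (intro sum.cong) auto
    then show ?thesis using that by simp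
  qed
  show "bounded_op H (jet_op a ?\<Psi> (\<lambda>w. w))"
  proof (rule jet_op_bounded[OF L1, of "\<lambda>h. h"])
    show "bounded_op H2 (\<lambda>h. h)" by (auto simp: bounded_op_def intro!: exI[of _ 1])
  qed (simp_all add: a delta del: mem_ball mem_ball_0)
  fix f assume f: "f \<in> carr H"
  show "jet_op a ?\<Psi> (\<lambda>w. w) f = mult_fun a f"
    using H.extensional[OF f] delta by (auto simp: jet_op_def mult_fun_def fun_eq_iff)
qed

lemma jet_op_jet_coeff_bounded:
  assumes L1: "bounded_op H1 L1" and L2: "bounded_op H2 L2"
    and \<phi>: "\<phi> holomorphic_on ball 0 1" "\<And>w. w \<in> ball 0 1 \<Longrightarrow> \<phi> w \<in> ball 0 1"
    and g: "g holomorphic_on ball 0 1"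
    and a: "\<And>h w. h \<in> carr H1 \<Longrightarrow> w \<in> ball 0 1 \<Longrightarrow> L1 h w 0 = a w * h (\<phi> w) 0"
    and L2_eq: "\<And>h w. h \<in> carr H2 \<Longrightarrow> w \<in> ball 0 1 \<Longrightarrow> L2 h w 0 = g w * h (\<phi> w) 0"
  shows "bounded_op H (jet_op a (jet_coeff g \<phi>) \<phi>)"
proof (rule jet_op_bounded[OF L1 L2 \<phi>(2) a])
  fix h w j assume h: "h \<in> carr H2" and w: "w \<in> ball (0::complex) 1" and j: "j < N"
  have "(deriv ^^ j) (\<lambda>z. L2 h z 0) w = (deriv ^^ j) (\<lambda>z. g z * h (\<phi> z) 0) w"
  proof (rule higher_deriv_cong_ev)
    show "\<forall>\<^sub>F z in nhds w. L2 h z 0 = g z * h (\<phi> z) 0"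
      using eventually_nhds_in_open[OF open_ball w] by eventually_elim (rule L2_eq[OF h])
  qed simp
  also have "\<dots> = (\<Sum>l<N. jet_coeff g \<phi> j l w * (deriv ^^ l) (\<lambda>z. h z 0) (\<phi> w))"
    by (rule higher_deriv_weighted_composition_lessThan[OF g \<phi>(1) H2.holomorphic_component[OF h]
          open_ball open_ball \<phi>(2) w j])
  finally show "(deriv ^^ j) (\<lambda>z. L2 h z 0) w = (\<Sum>l<N. jet_coeff g \<phi> j l w * (deriv ^^ l) (\<lambda>z. h z 0) (\<phi> w))" .
qed auto

lemma jet_op_inverse:
  assumes f: "f \<in> carr H" and g: "g holomorphic_on ball 0 1" "g' holomorphic_on ball 0 1"
    and \<phi>: "\<phi> holomorphic_on ball 0 1" "\<phi>' holomorphic_on ball 0 1"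
    and maps: "\<And>w. w \<in> ball 0 1 \<Longrightarrow> \<phi> w \<in> ball 0 1" "\<And>w. w \<in> ball 0 1 \<Longrightarrow> \<phi>' w \<in> ball 0 1"
    and inv: "\<And>w. w \<in> ball 0 1 \<Longrightarrow> \<phi>' (\<phi> w) = w" and ginv: "\<And>w. w \<in> ball 0 1 \<Longrightarrow> g w * g' (\<phi> w) = 1"
    and ainv: "\<And>w. w \<in> ball 0 1 \<Longrightarrow> a w * a' (\<phi> w) = 1"
  shows "jet_op a (jet_coeff g \<phi>) \<phi> (jet_op a' (jet_coeff g' \<phi>') \<phi>' f) = f"
proof (intro ext)
  fix z i
  show "jet_op a (jet_coeff g \<phi>) \<phi> (jet_op a' (jet_coeff g' \<phi>') \<phi>' f) z i = f z i"
  proof (cases "z \<in> ball 0 1 \<and> i < N")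
    case True
    then have z: "z \<in> ball 0 1" and i: "i < N" by auto
    have "jet_op a (jet_coeff g \<phi>) \<phi> (jet_op a' (jet_coeff g' \<phi>') \<phi>' f) z i
        = a z * (\<Sum>l<N. jet_coeff g \<phi> i l z * (a' (\<phi> z) * (\<Sum>m<N. jet_coeff g' \<phi>' l m (\<phi> z) * f z m)))"
      using z i maps(1)[OF z] inv[OF z] by (simp add: jet_op_def)
    also have "\<dots> = (a z * a' (\<phi> z)) *
        (\<Sum>l<N. \<Sum>m<N. jet_coeff g \<phi> i l z * jet_coeff g' \<phi>' l m (\<phi> z) * f z m)"
      by (simp add: sum_distrib_left mult_ac)
    also have "\<dots> = (\<Sum>m<N. (\<Sum>l<N. jet_coeff g \<phi> i l z * jet_coeff g' \<phi>' l m (\<phi> z)) * f z m)"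
      unfolding ainv[OF z] mult_1 sum_distrib_right by (rule sum.swap)
    also have "\<dots> = (\<Sum>m<N. if m = i then f z m else 0)"
      using jet_coeff_inverse[OF g(1) \<phi>(1) g(2) \<phi>(2) open_ball open_ball maps inv ginv z i]
      by (intro sum.cong) auto
    finally show ?thesis using i by simp
  next
    case False
    then show ?thesis using H.extensional[OF f, of z i] by (auto simp: jet_op_def)
  qed
qed

lemma weakly_homogeneous_jet:
  assumes sharp: "sharp K1 H1" "sharp K2 H2"
    and pd: "positive_definite 1 (scalar_kernel K1)" "positive_definite 1 (scalar_kernel K2)"
    and wh: "weakly_homogeneous H1 mult_z" "weakly_homogeneous H2 mult_z"
  shows "weakly_homogeneous H mult_z"
proof -
  have M1: "bounded_op H1 mult_z" and spec1: "op_spectrum H1 mult_z \<subseteq> cball 0 1"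
    using wh(1) by (auto simp: weakly_homogeneous_def)
  have M: "bounded_op H mult_z"
    unfolding mult_z_eq_mult_fun by (rule mult_fun_bounded[OF M1]) (simp add: mult_z_def)
  have R: "bounded_op H (mult_fun (\<lambda>z. 1 / (\<zeta> - z)))" if "1 < cmod \<zeta>" for \<zeta>
    by (rule mult_fun_bounded[OF H1.bounded_resolvent_mult_fun(1)[OF spec1 that]]) (simp add: mult_fun_def)
  have spec: "op_spectrum H mult_z \<subseteq> cball 0 1"
    using H.invertible_resolvent[OF M R] by (force simp: op_spectrum_def)
  have "\<exists>A. disc_calculus H mult_z \<phi> A \<and> similar_op H A mult_z" if \<phi>: "\<phi> \<in> moeb" for \<phi>
  proof -
    define \<phi>' where "\<phi>' = inv_into (ball 0 1) \<phi>"
    have bij: "bij_betw \<phi> (ball 0 1) (ball 0 1)" and hol: "\<phi> holomorphic_on ball 0 1" "\<phi>' holomorphic_on ball 0 1"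
      using \<phi> by (auto simp: moeb_def \<phi>'_def)
    have maps: "\<phi> w \<in> ball 0 1" if "w \<in> ball 0 1" for w using bij that by (rule bij_betw_apply)
    have maps': "\<phi>' w \<in> ball 0 1" if "w \<in> ball 0 1" for w
      unfolding \<phi>'_def using bij_betw_inv_into[OF bij] that by (rule bij_betw_apply)
    have inv: "\<phi>' (\<phi> w) = w" "\<phi> (\<phi>' w) = w" if "w \<in> ball 0 1" for w
      unfolding \<phi>'_def using bij_betw_inv_into_left[OF bij that] bij_betw_inv_into_right[OF bij that] by auto
    obtain A1 where A1: "disc_calculus H1 mult_z \<phi> A1"
      using wh(1) \<phi> unfolding weakly_homogeneous_def by blast
    then obtain r F where r: "1 < r" and F: "F analytic_on cball 0 r" "\<And>z. z \<in> ball 0 1 \<Longrightarrow> F z = \<phi> z"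
      unfolding disc_calculus_def by blast
    have "bounded_op H1 A1" using A1 by (simp add: disc_calculus_def)
    then have M\<phi>: "bounded_op H (mult_fun \<phi>)"
      by (rule mult_fun_bounded) (rule H1.disc_calculus_apply[OF spec1 A1], simp_all)
    have calc: "disc_calculus H mult_z \<phi> (mult_fun \<phi>)"
      by (rule H.disc_calculus_mult_fun[OF M R r F M\<phi>])
    obtain L1 L1' g1 where L1: "bounded_op H1 L1" "bounded_op H1 L1'"
      and g1: "g1 holomorphic_on ball 0 1" "\<And>w. w \<in> ball 0 1 \<Longrightarrow> g1 w \<noteq> 0"
      and L1_eq: "\<And>h w. h \<in> carr H1 \<Longrightarrow> w \<in> ball 0 1 \<Longrightarrow> L1 h w 0 = g1 w * h (\<phi> w) 0"
        "\<And>h w. h \<in> carr H1 \<Longrightarrow> w \<in> ball 0 1 \<Longrightarrow> L1' h w 0 = 1 / g1 (\<phi>' w) * h (\<phi>' w) 0"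
      using H1.weakly_homogeneous_weighted_composition[OF sharp(1) pd(1) wh(1) \<phi>] unfolding \<phi>'_def by blast
    obtain L2 L2' g2 where L2: "bounded_op H2 L2" "bounded_op H2 L2'"
      and g2: "g2 holomorphic_on ball 0 1" "\<And>w. w \<in> ball 0 1 \<Longrightarrow> g2 w \<noteq> 0"
      and L2_eq: "\<And>h w. h \<in> carr H2 \<Longrightarrow> w \<in> ball 0 1 \<Longrightarrow> L2 h w 0 = g2 w * h (\<phi> w) 0"
        "\<And>h w. h \<in> carr H2 \<Longrightarrow> w \<in> ball 0 1 \<Longrightarrow> L2' h w 0 = 1 / g2 (\<phi>' w) * h (\<phi>' w) 0"
      using H2.weakly_homogeneous_weighted_composition[OF sharp(2) pd(2) wh(2) \<phi>] unfolding \<phi>'_def by blast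
    define a' where "a' w = 1 / g1 (\<phi>' w)" for w
    define g' where "g' w = 1 / g2 (\<phi>' w)" for w
    have "\<phi>' ` ball 0 1 \<subseteq> ball 0 1" using maps' by blast
    from holomorphic_on_compose_gen[OF hol(2) g2(1) this] have g': "g' holomorphic_on ball 0 1"
      unfolding g'_def o_def by (rule holomorphic_on_divide[OF holomorphic_on_const]) (rule g2(2)[OF maps'])
    define T where "T = jet_op g1 (jet_coeff g2 \<phi>) \<phi>"
    define T' where "T' = jet_op a' (jet_coeff g' \<phi>') \<phi>'"
    have bT: "bounded_op H T"
      unfolding T_def by (rule jet_op_jet_coeff_bounded[OF L1(1) L2(1) hol(1) maps g2(1) L1_eq(1) L2_eq(1)])
    have bT': "bounded_op H T'"
      unfolding T'_def
      by (rule jet_op_jet_coeff_bounded[OF L1(2) L2(2) hol(2) maps' g'])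
        (simp_all add: L1_eq(2) L2_eq(2) a'_def g'_def del: mem_ball mem_ball_0)
    have TT': "T (T' f) = f" if "f \<in> carr H" for f
      unfolding T_def T'_def
      by (rule jet_op_inverse[OF that g2(1) g' hol maps maps' inv(1)])
        (simp_all add: g'_def a'_def inv(1) g1(2) g2(2) del: mem_ball mem_ball_0)
    have T'T: "T' (T f) = f" if "f \<in> carr H" for f
      unfolding T_def T'_def
      by (rule jet_op_inverse[OF that g' g2(1) hol(2,1) maps' maps inv(2)])
        (simp_all add: g'_def a'_def g1(2) g2(2) maps' del: mem_ball mem_ball_0)
    have memT: "T f \<in> carr H" "T' f \<in> carr H" if "f \<in> carr H" for f
      using bT bT' that by (simp_all add: bounded_op_def)
    have bijT: "bij_betw T (carr H) (carr H)"
    proof (rule bij_betw_byWitness[where f' = T'])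
      show "\<forall>f\<in>carr H. T' (T f) = f" using T'T by blast
      show "\<forall>f\<in>carr H. T (T' f) = f" using TT' by blast
    qed (use memT in blast)+
    have invT: "T' f = inv_into (carr H) T f" if "f \<in> carr H" for f
      by (rule inv_into_f_eq[OF bij_betw_imp_inj_on[OF bijT], symmetric]) (rule memT(2)[OF that], rule TT'[OF that])
    have "invertible_op H T"
      unfolding invertible_op_def using bT bijT H.bounded_op_cong[OF bT' invT] by blast
    moreover have "mult_fun \<phi> f = T (mult_z (inv_into (carr H) T f))" if f: "f \<in> carr H" for f
    proof -
      have "T (mult_z h) = mult_fun \<phi> (T h)" for h
        by (auto simp: T_def jet_op_def mult_z_def mult_fun_def fun_eq_iff sum_distrib_left mult_ac)
      then show ?thesis using TT'[OF f] invT[OF f] by metis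
    qed
    ultimately have "similar_op H (mult_fun \<phi>) mult_z" unfolding similar_op_def by blast
    then show ?thesis using calc by blast
  qed
  then show ?thesis unfolding weakly_homogeneous_def using M spec by blast
qed

end

theorem theorem2p9:
  fixes K1 K2 :: "complex \<Rightarrow> complex \<Rightarrow> complex" and n :: nat and H1 H2 H :: hspace
  assumes "sesqui_holomorphic 1 (scalar_kernel K1)" and "sesqui_holomorphic 1 (scalar_kernel K2)"
    and "positive_definite 1 (scalar_kernel K1)" and "positive_definite 1 (scalar_kernel K2)"
    and "rkhs 1 (scalar_kernel K1) H1" and "rkhs 1 (scalar_kernel K2) H2"
    and "sharp K1 H1" and "sharp K2 H2"
    and "weakly_homogeneous H1 mult_z" and "weakly_homogeneous H2 mult_z"
    and "rkhs (n + 1) (jet_kernel K1 K2) H"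
  shows "weakly_homogeneous H mult_z"
proof -
  interpret jet_space K1 K2 "n + 1" H1 H2 H
    using assms by (intro jet_space.intro scalar_rkhs.intro)
  show ?thesis by (rule weakly_homogeneous_jet) (use assms in auto)
qed

end
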